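(* Let $q$ be a prime power, $w\in\mathbb{F}_q^*$, and define $$h(x)=\frac{x^3-3w^2x+w^3}{x(x-w)}\in\mathbb{F}_q(x).$$ Then the extension $\mathbb{F}_q(x)/\mathbb{F}_q(h(x))$ is Galois and: (i) If $q=3^m$, then $\#T^1_{split}(h)=\frac{q}{3}$, and $h$ is $(2,\frac{q}{3})$-good. (ii) If $q\equiv1\pmod 3$, then $\#T^1_{split}(h)=\frac{q-1}{3}$, and $h$ is $(2,\frac{q-1}{3})$-good. (iii) If $q\equiv2\pmod 3$, then $\#T^1_{split}(h)=\frac{q+1}{3}$, and $h$ is $(2,\frac{q+1}{3})$-good.
   Context: $\mathbb{P}^1(\mathbb{F}_q)=\mathbb{F}_q\cup\{\infty\}$; a rational function $h=f/g$ ($f,g$ coprime) has degree $\max\{\deg f,\deg g\}$ and induces a map $\mathbb{P}^1(\mathbb{F}_q)\to\mathbb{P}^1(\mathbb{F}_q)$ by evaluation. $h$ is $(r,l)$-good ($l\geq1$) if $\deg(h)=r+1$ and there exist $l$ pairwise disjoint subsets $A_1,\dots,A_l$ of $\mathbb{P}^1(\mathbb{F}_q)$ with $|A_i|=r+1$ and $h(A_i)=\{t_i\}$ for some $t_i\in\mathbb{P}^1(\mathbb{F}_q)$. With $t=h(x)$, $T^1_{split}(h)$ is the set of rational (degree-one) places of $\mathbb{F}_q(t)$ that split totally in $\mathbb{F}_q(x)/\mathbb{F}_q(t)$, i.e. over which there lie exactly $\deg(h)$ places of $\mathbb{F}_q(x)$; equivalently, it corresponds to the set of $P\in\mathbb{P}^1(\mathbb{F}_q)$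 with $\#\{Q\in\mathbb{P}^1(\mathbb{F}_q):h(Q)=P\}=\deg(h)$. *)

theory Defs
  imports
    "HOL-Computational_Algebra.Polynomial"
    "HOL-Computational_Algebra.Fraction_Field"
    "HOL-Library.Disjoint_Sets"
    "HOL-Library.Cardinality"
begin

text \<open>
  For a field \<^typ>\<open>'a\<close>, the rational function field over \<^typ>\<open>'a\<close> is \<^typ>\<open>'a poly fract\<close>.
  Its subfields are sets of rational functions.
\<close>

definition const_rf :: "'a::field \<Rightarrow> 'a poly fract"
  where "const_rf c = Fract [:c:] 1"

definition var_rf :: "'a::field poly fract"
  where "var_rf = Fract [:0, 1:] 1"

text \<open>
  The representation of a rational function in lowest terms; the denominator is taken monic
  to make the representation unique.
\<close>

definition lowest_terms :: "'a::field poly fract \<Rightarrow> 'a poly \<times> 'a poly"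
  where "lowest_terms h =
    (THE (f, g). lead_coeff g = 1 \<and> coprime f g \<and> h = Fract f g)"

definition rf_degree :: "'a::field poly fract \<Rightarrow> nat"
  where "rf_degree h = (case lowest_terms h of (f, g) \<Rightarrow> max (degree f) (degree g))"


subsection \<open>Evaluation on the projective line\<close>

text \<open>
  The projective line over \<^typ>\<open>'a\<close> is \<^typ>\<open>'a option\<close>, with \<^const>\<open>None\<close> as the point at infinity.
  The value at infinity is \<open>[a : b]\<close> where \<open>a\<close>, \<open>b\<close> are the coefficients of numerator and denominator
  in degree \<open>rf_degree h\<close>, that is, the value at \<open>[1 : 0]\<close> of the homogenized pair.
\<close>

definition proj_quot :: "'a::field \<Rightarrow> 'a \<Rightarrow> 'a option"
  where "proj_quot a b = (if b = 0 then None else Some (a / b))"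

definition rf_eval :: "'a::field poly fract \<Rightarrow> 'a option \<Rightarrow> 'a option"
  where "rf_eval h P = (case lowest_terms h of (f, g) \<Rightarrow>
    (case P of
       Some a \<Rightarrow> proj_quot (poly f a) (poly g a)
     | None \<Rightarrow> proj_quot (coeff f (rf_degree h)) (coeff g (rf_degree h))))"

definition good_rf :: "nat \<Rightarrow> nat \<Rightarrow> 'a::field poly fract \<Rightarrow> bool"
  where "good_rf r l h \<longleftrightarrow> l \<ge> 1 \<and> rf_degree h = r + 1 \<and>
    (\<exists>A :: nat \<Rightarrow> 'a option set. disjoint_family_on A {1..l} \<and>
       (\<forall>i\<in>{1..l}. card (A i) = r + 1 \<and> (\<exists>t. rf_eval h ` A i = {t})))"


subsection \<open>Field extensions\<close>

definition is_subfield :: "'b::field set \<Rightarrow> bool"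
  where "is_subfield K \<longleftrightarrow> 1 \<in> K \<and>
    (\<forall>x\<in>K. \<forall>y\<in>K. x - y \<in> K \<and> x * y \<in> K) \<and> (\<forall>x\<in>K. inverse x \<in> K)"

definition const_adjoin :: "'a::field poly fract \<Rightarrow> 'a poly fract set"
  where "const_adjoin t = \<Inter>{K. is_subfield K \<and> range const_rf \<subseteq> K \<and> t \<in> K}"

definition field_auts_fixing :: "'b::field set \<Rightarrow> ('b \<Rightarrow> 'b) set"
  where "field_auts_fixing K = {\<sigma>. bij \<sigma> \<and>
    (\<forall>x y. \<sigma> (x + y) = \<sigma> x + \<sigma> y \<and> \<sigma> (x * y) = \<sigma> x * \<sigma> y) \<and> (\<forall>x\<in>K. \<sigma> x = x)}"

text \<open>
  The extension of \<open>K\<close> by the ambient field is Galois: it is algebraic, and \<open>K\<close> is the fixed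
  field of the group of automorphisms of the ambient field over \<open>K\<close>.
\<close>

definition galois_over :: "'b::field set \<Rightarrow> bool"
  where "galois_over K \<longleftrightarrow> is_subfield K \<and>
    (\<forall>z. \<exists>p. p \<noteq> 0 \<and> (\<forall>i. coeff p i \<in> K) \<and> poly p z = 0) \<and>
    {z. \<forall>\<sigma>\<in>field_auts_fixing K. \<sigma> z = z} = K"


subsection \<open>Places\<close>

text \<open>
  As in Stichtenoth's book, a place of a function field \<open>K\<close> with constant field \<^typ>\<open>'a\<close> is the maximal
  ideal of a valuation ring of \<open>K\<close>, and a place \<open>Q\<close> of the rational function field lies over a place
  \<open>P\<close> of a subfield iff \<open>P \<subseteq> Q\<close>.
\<close>

definition valuation_ring :: "'a::field poly fract set \<Rightarrow> 'a poly fract set \<Rightarrow> bool"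
  where "valuation_ring K V \<longleftrightarrow> range const_rf \<subset> V \<and> V \<subset> K \<and>
    (\<forall>x\<in>V. \<forall>y\<in>V. x - y \<in> V \<and> x * y \<in> V) \<and>
    (\<forall>z\<in>K. z \<in> V \<or> inverse z \<in> V)"

definition nonunits :: "'b::field set \<Rightarrow> 'b set"
  where "nonunits V = {z \<in> V. z = 0 \<or> inverse z \<notin> V}"

definition places :: "'a::field poly fract set \<Rightarrow> 'a poly fract set set"
  where "places K = {nonunits V | V. valuation_ring K V}"

text \<open>
  A place is rational (of degree one) if its residue field is the field of constants, that is, if
  every residue class contains a constant.
\<close>

definition rational_places :: "'a::field poly fract set \<Rightarrow> 'a poly fract set set"
  where "rational_places K = {nonunits V | V. valuation_ring K V \<and>
    (\<forall>z\<in>V. \<exists>c. z - const_rf c \<in> nonunits V)}"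

definition T1_split :: "'a::field poly fract \<Rightarrow> 'a poly fract set set"
  where "T1_split h = {P \<in> rational_places (const_adjoin h).
    card {Q \<in> places UNIV. P \<subseteq> Q} = rf_degree h}"

end

theory Submission
  imports Defs "HOL-Computational_Algebra.Polynomial_Factorial"
begin

text \<open>
  The substitution \<open>\<sigma>: x \<mapsto> w\<^sup>2 / (w - x)\<close> has order three, and \<open>h = x + \<sigma> x + \<sigma>\<^sup>2 x\<close>. Every rational function
  can be written with a \<open>\<sigma>\<close>-invariant denominator and a numerator in \<open>K + K x + K x\<^sup>2\<close>,
  where \<open>K\<close> is generated by \<open>h\<close>, and a \<open>\<sigma>\<close>-invariant element of that module lies in \<open>K\<close>; hence \<open>K\<close> is the
  fixed field of \<open>\<sigma>\<close>. On the projective line the nonempty fibres of \<open>h\<close> are the orbits of \<open>\<sigma>\<close>, and the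
  places over a rational place with nonempty fibre are the rational places at the points of the
  fibre; if the fibre is empty, then an irreducible cubic leaves at most one place. So the totally split
  places correspond to the orbits of size three. Since \<open>\<sigma>\<close> has at most two fixed points, \<open>q + 1 = fix + 3 l\<close>
  forces \<open>l = (q + 1) div 3\<close> in all three cases.
\<close>

section \<open>The constants inside the rational function field\<close>

lemma const_rf_simps [simp]:
  "const_rf 0 = 0" "const_rf 1 = 1"
  "const_rf (a + b) = const_rf a + const_rf b"
  "const_rf (a - b) = const_rf a - const_rf b"
  "const_rf (a * b) = const_rf a * const_rf b"
  "const_rf (- a) = - const_rf a"
  "const_rf (inverse a) = inverse (const_rf a)"
  "const_rf (a / b) = const_rf a / const_rf b"
  by (simp_all add: const_rf_def Zero_fract_def One_fract_def one_pCons)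
    (cases "a = 0"; cases "b = 0"; simp add: Zero_fract_def eq_fract one_pCons field_simps)+

lemma const_rf_eq_iff [simp]: "const_rf a = const_rf b \<longleftrightarrow> a = b"
  by (simp add: const_rf_def eq_fract)

lemma const_rf_eq_0_iff [simp]: "const_rf a = 0 \<longleftrightarrow> a = 0"
  using const_rf_eq_iff[of a 0] by (simp del: const_rf_eq_iff)

lemma const_rf_power [simp]: "const_rf (a ^ n) = const_rf a ^ n"
  by (induction n) simp_all

lemma const_rf_numeral [simp]: "const_rf (numeral n) = numeral n"
proof -
  have "const_rf (of_nat k :: 'a) = of_nat k" for k
    by (induction k) simp_all
  from this[of "numeral n"] show ?thesis by simp
qed

subsection \<open>Substitution into rational functions\<close>

text \<open>The ring homomorphism that sends the variable to \<open>s\<close>. At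
  \<open>s = var_rf\<close> it is the canonical embedding of polynomials, and quotients of its
  values stand for \<open>Fract\<close>.\<close>

definition ev :: "'a::field poly fract \<Rightarrow> 'a poly \<Rightarrow> 'a poly fract"
  where "ev s p = poly (map_poly const_rf p) s"

lemma ev_0 [simp]: "ev s 0 = 0"
  by (simp add: ev_def)

lemma ev_pCons [simp]: "ev s (pCons a p) = const_rf a + s * ev s p"
  by (simp add: ev_def map_poly_pCons)

lemma ev_1 [simp]: "ev s 1 = 1"
  by (simp add: one_pCons)

lemma ev_add [simp]: "ev s (p + q) = ev s p + ev s q"
  by (induction p q rule: poly_induct2) (simp_all add: algebra_simps)

lemma ev_uminus [simp]: "ev s (- p) = - ev s p"
  by (induction p) simp_all

lemma ev_diff [simp]: "ev s (p - q) = ev s p - ev s q"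
  using ev_add[of s p "- q"] by simp

lemma ev_smult [simp]: "ev s (smult c p) = const_rf c * ev s p"
  by (induction p) (simp_all add: algebra_simps)

lemma ev_mult [simp]: "ev s (p * q) = ev s p * ev s q"
  by (induction p) (simp_all add: algebra_simps)

lemma ev_var: "ev var_rf p = Fract p 1"
  by (induction p) (simp_all add: Zero_fract_def const_rf_def var_rf_def)

lemma Fract_eq_ev: "Fract f g = ev var_rf f / ev var_rf g"
  by (simp add: ev_var)

lemma ev_var_eq_0_iff [simp]: "ev var_rf p = 0 \<longleftrightarrow> p = 0"
  by (simp add: ev_var Zero_fract_def eq_fract)

lemma rational_function_cases:
  fixes z :: "'a::field poly fract"
  obtains f g where "g \<noteq> 0" "z = ev var_rf f / ev var_rf g"
  by (cases z) (auto simp: Fract_eq_ev)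

locale transcendental =
  fixes s :: "'a::field poly fract"
  assumes ev_eq_0_imp: "ev s p = 0 \<Longrightarrow> p = 0"
begin

text \<open>The extension of \<open>ev s\<close> to fractions, a field embedding sending
  \<open>var_rf\<close> to \<open>s\<close>. The description is well defined because
  \<open>ev s\<close> kills no nonzero denominator.\<close>

definition subst :: "'a poly fract \<Rightarrow> 'a poly fract"
  where "subst z = (THE y. \<exists>f g. g \<noteq> 0 \<and> z = Fract f g \<and> y = ev s f / ev s g)"

lemma ev_eq_0_iff [simp]: "ev s p = 0 \<longleftrightarrow> p = 0"
  using ev_eq_0_imp by auto

lemma subst_Fract: "subst (Fract f g) = ev s f / ev s g"
proof (cases "g = 0")
  case True
  \<comment> \<open>\<open>Fract f 0\<close> is zero by convention and so is division by
    \<open>ev s 0 = 0\<close>; the formula survives a zero denominator.\<close>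
  have "Fract f 0 = Fract 0 1"
    by (simp add: fract_collapse)
  moreover have "subst (Fract 0 1) = 0"
    unfolding subst_def
    by (rule the_equality, rule exI[of _ 0], rule exI[of _ 1]) (auto simp: eq_fract)
  ultimately show ?thesis using True by simp
next
  case False
  show ?thesis
    unfolding subst_def
  proof (rule the_equality)
    fix y assume "\<exists>f' g'. g' \<noteq> 0 \<and> Fract f g = Fract f' g' \<and> y = ev s f' / ev s g'"
    then obtain f' g' where *: "g' \<noteq> 0" "Fract f g = Fract f' g'" "y = ev s f' / ev s g'"
      by blast
    have "ev s (f * g') = ev s (f' * g)"
      using * False by (simp add: eq_fract)
    then show "y = ev s f / ev s g"
      using * False by (simp add: frac_eq_eq)
  qed (use False in blast)
qed

lemma subst_ev_var [simp]: "subst (ev var_rf p) = ev s p"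
  by (simp add: ev_var subst_Fract)

lemma subst_const [simp]: "subst (const_rf c) = const_rf c"
  using subst_ev_var[of "[:c:]"] by simp

lemma subst_0 [simp]: "subst 0 = 0" and subst_1 [simp]: "subst 1 = 1"
  using subst_const[of 0] subst_const[of 1] by simp_all

lemma subst_var [simp]: "subst var_rf = s"
  using subst_ev_var[of "[:0,1:]"] by (simp del: subst_ev_var)

lemma subst_mult [simp]: "subst (y * z) = subst y * subst z"
  by (cases y; cases z) (simp add: subst_Fract)

lemma subst_add [simp]: "subst (y + z) = subst y + subst z"
  by (cases y; cases z) (simp add: subst_Fract field_simps)

lemma subst_uminus [simp]: "subst (- z) = - subst z"
  by (cases z) (simp add: subst_Fract)

lemma subst_diff [simp]: "subst (y - z) = subst y - subst z"
  using subst_add[of y "- z"] by simp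

lemma subst_inverse [simp]: "subst (inverse z) = inverse (subst z)"
  by (cases z) (simp add: subst_Fract)

lemma subst_divide [simp]: "subst (y / z) = subst y / subst z"
  by (simp add: divide_inverse)

lemma subst_power [simp]: "subst (z ^ n) = subst z ^ n"
  by (induction n) simp_all

lemma subst_numeral [simp]: "subst (numeral n) = numeral n"
  using subst_const[of "numeral n"] by simp

lemma subst_eq_0_iff [simp]: "subst z = 0 \<longleftrightarrow> z = 0"
  by (cases z) (simp add: Fract_eq_ev)

lemma subst_eq_iff [simp]: "subst y = subst z \<longleftrightarrow> y = z"
  using subst_eq_0_iff[of "y - z"] by simp

lemma inj_subst: "inj subst"
  by (rule injI) simp

end

subsection \<open>Valuation rings of the rational function field\<close>

locale valuation =
  fixes V :: "'a::field poly fract set"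
  assumes vr: "valuation_ring UNIV V"
begin

lemma const_mem [simp]: "const_rf c \<in> V"
  using vr by (auto simp: valuation_ring_def)

lemma diff_mem: "y \<in> V \<Longrightarrow> z \<in> V \<Longrightarrow> y - z \<in> V"
  and mult_mem: "y \<in> V \<Longrightarrow> z \<in> V \<Longrightarrow> y * z \<in> V"
  and mem_or_inverse_mem: "z \<in> V \<or> inverse z \<in> V"
  using vr by (auto simp: valuation_ring_def)

lemma zero_mem [simp]: "0 \<in> V" and one_mem [simp]: "1 \<in> V"
  using const_mem[of 0] const_mem[of 1] by simp_all

lemma uminus_mem: "z \<in> V \<Longrightarrow> - z \<in> V"
  using diff_mem[of 0 z] by simp

lemma add_mem: "y \<in> V \<Longrightarrow> z \<in> V \<Longrightarrow> y + z \<in> V"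
  using diff_mem[of y "- z"] uminus_mem[of z] by simp

lemma power_mem: "z \<in> V \<Longrightarrow> z ^ n \<in> V"
  by (induction n) (auto intro: mult_mem)

lemma ev_mem: "z \<in> V \<Longrightarrow> ev z p \<in> V"
  by (induction p) (auto intro: add_mem mult_mem)

lemma nonunit_mem: "z \<in> nonunits V \<Longrightarrow> z \<in> V"
  by (simp add: nonunits_def)

lemma inverse_nonunit: "z \<notin> V \<Longrightarrow> inverse z \<in> nonunits V"
  using mem_or_inverse_mem[of z] by (auto simp: nonunits_def)

lemma inverse_mem: "z \<in> V \<Longrightarrow> z \<notin> nonunits V \<Longrightarrow> inverse z \<in> V"
  by (auto simp: nonunits_def)

lemma one_not_nonunit [simp]: "1 \<notin> nonunits V"
  by (simp add: nonunits_def)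

lemma zero_nonunit [simp]: "0 \<in> nonunits V"
  by (simp add: nonunits_def)

lemma const_nonunit_iff [simp]: "const_rf c \<in> nonunits V \<longleftrightarrow> c = 0"
  using const_mem[of "inverse c"] by (auto simp: nonunits_def)

text \<open>If \<open>y * z\<close> were a unit, \<open>inverse z = y * inverse (y * z)\<close>
  would lie in \<open>V\<close>.\<close>

lemma mult_nonunit: "y \<in> V \<Longrightarrow> z \<in> nonunits V \<Longrightarrow> y * z \<in> nonunits V"
proof -
  assume *: "y \<in> V" "z \<in> nonunits V"
  have "inverse z \<in> V" if "y * z \<noteq> 0" "inverse (y * z) \<in> V"
    using mult_mem[OF *(1) that(2)] that(1) by (simp add: field_simps)
  with * show ?thesis by (auto simp: nonunits_def intro: mult_mem)
qed

lemma mult_nonunit': "y \<in> nonunits V \<Longrightarrow> z \<in> V \<Longrightarrow> y * z \<in> nonunits V"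
  using mult_nonunit[of z y] by (simp add: mult.commute)

lemma uminus_nonunit: "z \<in> nonunits V \<Longrightarrow> - z \<in> nonunits V"
  using mult_nonunit[of "- 1" z] uminus_mem[of 1] by simp

text \<open>The valuation property enters here: \<open>y / z\<close> or \<open>z / y\<close> lies in
  \<open>V\<close>, so the sum is a multiple of \<open>z\<close> or of \<open>y\<close> by an
  element of \<open>V\<close>.\<close>

lemma add_nonunit: "y \<in> nonunits V \<Longrightarrow> z \<in> nonunits V \<Longrightarrow> y + z \<in> nonunits V"
proof (cases "y = 0 \<or> z = 0")
  case False
  assume *: "y \<in> nonunits V" "z \<in> nonunits V"
  have eq: "y + z = (y / z + 1) * z" "y + z = (z / y + 1) * y"
    using False by (simp_all add: field_simps)
  have "y / z \<in> V \<or> z / y \<in> V"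
    using mem_or_inverse_mem[of "y / z"] by simp
  with * show "y + z \<in> nonunits V"
    by (metis eq add_mem mult_nonunit one_mem)
qed auto

lemma diff_nonunit: "y \<in> nonunits V \<Longrightarrow> z \<in> nonunits V \<Longrightarrow> y - z \<in> nonunits V"
  using add_nonunit[of y "- z"] uminus_nonunit[of z] by simp

lemma nonunit_mult_D: "y * z \<in> nonunits V \<Longrightarrow> y \<in> V \<Longrightarrow> y \<notin> nonunits V \<Longrightarrow> z \<in> nonunits V"
  using mult_nonunit[of "inverse y" "y * z"] inverse_mem[of y]
  by (cases "y = 0") (auto simp: field_simps)

lemma nonunit_mult_iff:
  "y \<in> V \<Longrightarrow> z \<in> V \<Longrightarrow> y * z \<in> nonunits V \<longleftrightarrow> y \<in> nonunits V \<or> z \<in> nonunits V"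
  using mult_nonunit mult_nonunit' nonunit_mult_D by blast

lemma unit_add_iff: "z \<in> nonunits V \<Longrightarrow> y + z \<in> nonunits V \<longleftrightarrow> y \<in> nonunits V"
  using add_nonunit[of y z] diff_nonunit[of "y + z" z] by auto

text \<open>Recovers the ring from its place, which is what \<open>nonunits_inject\<close> rests
  on.\<close>

lemma mem_iff: "z \<in> V \<longleftrightarrow> z = 0 \<or> inverse z \<notin> nonunits V"
  using mem_or_inverse_mem[of z] by (auto simp: nonunits_def)

text \<open>
  Dividing \<open>ev s p\<close> by \<open>s ^ degree p\<close> leaves the leading coefficient modulo nonunits.
\<close>

lemma transcendental_if_not_mem:
  assumes "s \<notin> V"
  shows "transcendental s"
proof
  have s: "s \<noteq> 0" "inverse s \<in> nonunits V"
    using assms inverse_nonunit by auto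
  have *: "ev s p / s ^ degree p - const_rf (lead_coeff p) \<in> nonunits V" for p
  proof (induction p)
    case (pCons a p)
    show ?case
    proof (cases "p = 0")
      case False
      let ?e = "ev s p / s ^ degree p - const_rf (lead_coeff p)"
      have "ev s (pCons a p) / s ^ degree (pCons a p) - const_rf (lead_coeff (pCons a p))
        = const_rf a * (inverse s ^ degree p * inverse s) + ?e"
        using False s by (simp add: field_simps)
      moreover have "inverse s ^ degree p \<in> V"
        using s by (simp add: nonunit_mem power_mem del: power_inverse)
      ultimately show ?thesis
        using pCons.IH s by (metis add_nonunit const_mem mult_nonunit)
    qed auto
  qed simp
  fix p assume "ev s p = 0"
  with *[of p] show "p = 0"
    using uminus_nonunit[of "- const_rf (lead_coeff p)"] by simp
qed

end

section \<open>Localizations of the polynomial ring at a prime\<close>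

definition local_ring :: "'a::field poly \<Rightarrow> 'a poly fract set"
  where "local_ring p = {ev var_rf f / ev var_rf g | f g. \<not> p dvd g}"

lemma local_ringI: "\<not> p dvd g \<Longrightarrow> ev var_rf f / ev var_rf g \<in> local_ring p"
  by (auto simp: local_ring_def)

text \<open>Common factors \<open>p\<close> are cancelled one by one; since \<open>p\<close> is not
  constant, each cancellation lowers the degree of the denominator.\<close>

lemma rational_function_cases_dvd:
  fixes z :: "'a::field poly fract"
  assumes "degree p > 0"
  obtains f g where "g \<noteq> 0" "z = ev var_rf f / ev var_rf g" "\<not> p dvd f \<or> \<not> p dvd g"
proof -
  have "\<exists>f' g'. g' \<noteq> 0 \<and> ev var_rf f / ev var_rf g = ev var_rf f' / ev var_rf g' \<and> (\<not> p dvd f' \<or> \<not> p dvd g')"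
    if "g \<noteq> 0" for f g :: "'a poly"
    using that
  proof (induction "degree g" arbitrary: f g rule: less_induct)
    case less
    show ?case
    proof (cases "p dvd f \<and> p dvd g")
      case True
      then obtain f' g' where *: "f = p * f'" "g = p * g'"
        by (auto elim!: dvdE)
      then have "degree g' < degree g" "g' \<noteq> 0" "p \<noteq> 0"
        using less.prems assms by (auto simp: degree_mult_eq)
      with less.hyps[of g' f'] * show ?thesis by simp
    qed (use less.prems in blast)
  qed
  then show thesis
    using that by (metis rational_function_cases)
qed

text \<open>Clearing denominators would give \<open>g * g' = f * f'\<close>, so the prime
  \<open>p\<close> would divide \<open>g\<close> or \<open>g'\<close>.\<close>

lemma inverse_not_mem_local_ring:
  assumes "prime_elem p" "f \<noteq> 0" "g \<noteq> 0" "p dvd f" "\<not> p dvd g"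
  shows "ev var_rf g / ev var_rf f \<notin> local_ring p"
proof
  assume "ev var_rf g / ev var_rf f \<in> local_ring p"
  then obtain f' g' where *: "\<not> p dvd g'" "ev var_rf g / ev var_rf f = ev var_rf f' / ev var_rf g'"
    by (auto simp: local_ring_def)
  then have "g' \<noteq> 0" by auto
  then have "ev var_rf (g * g') = ev var_rf (f * f')"
    using * assms by (simp add: field_simps)
  then have "ev var_rf (g * g' - f * f') = 0"
    by simp
  then have "g * g' = f * f'"
    unfolding ev_var_eq_0_iff by simp
  then have "p dvd g * g'"
    using assms by simp
  then show False
    using assms * by (simp add: prime_elem_dvd_mult_iff)
qed

lemma degree_prime_elem_pos:
  fixes p :: "'a::field poly"
  assumes "prime_elem p"
  shows "degree p > 0"
  using assms by (metis is_unit_iff_degree neq0_conv prime_elem_def)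

lemma nonunit_local_ring:
  assumes "prime_elem p" "p dvd f" "\<not> p dvd g"
  shows "ev var_rf f / ev var_rf g \<in> nonunits (local_ring p)"
  using assms inverse_not_mem_local_ring[of p f g] local_ringI[of p g f]
  by (cases "f = 0") (auto simp: nonunits_def)

text \<open>A valuation ring of the full field contains the variable or its inverse, so this makes
  the inclusion of the constants strict.\<close>

lemma const_not_var:
  "var_rf \<noteq> const_rf (c :: 'a::field)" "inverse var_rf \<noteq> const_rf c"
proof -
  have "ev var_rf [:-c, 1:] \<noteq> 0" "ev var_rf [:1, -c:] \<noteq> 0" "ev var_rf [:0, 1:] \<noteq> 0"
    unfolding ev_var_eq_0_iff by simp_all
  then have *: "var_rf \<noteq> const_rf c" "var_rf * const_rf c \<noteq> 1" "var_rf \<noteq> (0 :: 'a poly fract)"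
    by auto
  then show "var_rf \<noteq> const_rf c" "inverse var_rf \<noteq> const_rf c"
    using right_inverse[OF *(3)] by metis+
qed

lemma var_rf_nonzero [simp]: "var_rf \<noteq> 0"
  using const_not_var(1)[of 0] by simp

lemma valuation_local_ring:
  assumes p: "prime_elem p"
  shows "valuation (local_ring p)"
proof
  have np1: "\<not> p dvd 1"
    using p by (simp add: prime_elem_def)
  have ev_mem: "ev var_rf f \<in> local_ring p" for f
    using local_ringI[OF np1, of f] by simp
  have const: "const_rf c \<in> local_ring p" for c
    using ev_mem[of "[:c:]"] by simp
  have "var_rf \<in> local_ring p"
    using ev_mem[of "[:0,1:]"] by simp
  with const const_not_var(1) have "range const_rf \<subset> local_ring p"
    by blast
  moreover have "local_ring p \<noteq> UNIV"
    using inverse_not_mem_local_ring[of p p 1] p np1 by auto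
  moreover have "y - z \<in> local_ring p \<and> y * z \<in> local_ring p"
    if yz: "y \<in> local_ring p" "z \<in> local_ring p" for y z
  proof -
    from yz obtain f g f' g' where *: "\<not> p dvd g" "\<not> p dvd g'"
      "y = ev var_rf f / ev var_rf g" "z = ev var_rf f' / ev var_rf g'"
      by (auto simp: local_ring_def)
    then have nz: "g \<noteq> 0" "g' \<noteq> 0" by auto
    have "y * z = ev var_rf (f * f') / ev var_rf (g * g')"
      and "y - z = ev var_rf (f * g' - f' * g) / ev var_rf (g * g')"
      using nz by (simp_all add: *(3,4) field_simps)
    moreover have "\<not> p dvd g * g'"
      using * p by (simp add: prime_elem_dvd_mult_iff)
    ultimately show ?thesis
      by (metis local_ringI)
  qed
  moreover have "z \<in> local_ring p \<or> inverse z \<in> local_ring p" for z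
  proof -
    obtain f g where "g \<noteq> 0" "z = ev var_rf f / ev var_rf g" "\<not> p dvd f \<or> \<not> p dvd g"
      using rational_function_cases_dvd degree_prime_elem_pos[OF p] by blast
    then show ?thesis
      using local_ringI[of p g f] local_ringI[of p f g] by auto
  qed
  ultimately show "valuation_ring UNIV (local_ring p)"
    by (auto simp: valuation_ring_def const)
qed

context valuation
begin

text \<open>
  A polynomial of least degree among the nonzero ones in the place divides all the others,
  hence it is associated to \<open>p\<close>.
\<close>

lemma ev_nonunit_imp_dvd:
  assumes "var_rf \<in> V" "irreducible p" "ev var_rf p \<in> nonunits V" "ev var_rf g \<in> nonunits V"
  shows "p dvd g"
proof -
  define I where "I = {f. f \<noteq> 0 \<and> ev var_rf f \<in> nonunits V}"
  have "p \<in> I"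
    using assms by (auto simp: I_def)
  then obtain m where m: "m \<in> I" "\<And>f. f \<in> I \<Longrightarrow> degree m \<le> degree f"
    using arg_min_natI[of "\<lambda>f. f \<in> I" p degree] arg_min_nat_le[of "\<lambda>f. f \<in> I" _ degree] by metis
  have m_dvd: "m dvd f" if "ev var_rf f \<in> nonunits V" for f
  proof -
    have "ev var_rf (f mod m) = ev var_rf f - ev var_rf (f div m) * ev var_rf m"
      unfolding ev_mult[symmetric] ev_diff[symmetric] by (simp add: minus_div_mult_eq_mod)
    then have "ev var_rf (f mod m) \<in> nonunits V"
      using that m ev_mem[OF assms(1)] by (auto simp: I_def intro!: diff_nonunit mult_nonunit)
    then have "f mod m = 0"
      using m degree_mod_less[of m f] by (force simp: I_def)
    then show ?thesis by (simp add: mod_eq_0_iff_dvd)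
  qed
  have "\<not> m dvd 1"
  proof
    assume "m dvd 1"
    then obtain k where "m * k = 1"
      by (auto elim: dvdE)
    then have "ev var_rf k * ev var_rf m = 1"
      by (metis ev_1 ev_mult mult.commute)
    then show False
      using m mult_nonunit[OF ev_mem[OF assms(1)], of "ev var_rf m" k] by (simp add: I_def)
  qed
  moreover obtain k where "p = m * k"
    using m_dvd[OF assms(3)] by (auto elim: dvdE)
  ultimately have "k dvd 1"
    using irreducibleD[OF assms(2)] by blast
  then have "p dvd m"
    using \<open>p = m * k\<close> by simp
  then show ?thesis
    using m_dvd[OF assms(4)] dvd_trans by blast
qed

text \<open>Polynomials not divisible by \<open>p\<close> are units of \<open>V\<close>, which gives
  one inclusion. Conversely, if \<open>z\<close> is in \<open>V\<close> and \<open>p\<close> divides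
  its denominator \<open>g\<close>, then the numerator \<open>z * ev var_rf g\<close> lies in the
  place, so \<open>p\<close> divides it too.\<close>

lemma eq_local_ring:
  assumes "var_rf \<in> V" "irreducible p" "ev var_rf p \<in> nonunits V"
  shows "V = local_ring p"
proof
  note mem = ev_mem[OF assms(1)]
  have unit: "ev var_rf g \<notin> nonunits V" if "\<not> p dvd g" for g
    using ev_nonunit_imp_dvd[OF assms] that by blast
  show "local_ring p \<subseteq> V"
    using unit by (auto simp: local_ring_def divide_inverse intro!: mult_mem mem inverse_mem)
  show "V \<subseteq> local_ring p"
  proof
    fix z assume z: "z \<in> V"
    have "degree p > 0"
      using assms(2) by (metis irreducible_def is_unit_iff_degree neq0_conv)
    then obtain f g where fg: "g \<noteq> 0" "z = ev var_rf f / ev var_rf g" "\<not> p dvd f \<or> \<not> p dvd g"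
      by (rule rational_function_cases_dvd)
    show "z \<in> local_ring p"
    proof (cases "p dvd g")
      case True
      then obtain k where "g = k * p" by (metis dvdE mult.commute)
      then have "ev var_rf g \<in> nonunits V"
        using mult_nonunit[OF mem assms(3)] by simp
      then have "z * ev var_rf g \<in> nonunits V"
        by (rule mult_nonunit[OF z])
      then show ?thesis
        using fg unit True by auto
    qed (use fg local_ringI in blast)
  qed
qed

end

subsection \<open>Transport along substitutions\<close>

lemma valuation_iff: "valuation V \<longleftrightarrow> valuation_ring UNIV V"
  by (simp add: valuation_def)

context transcendental
begin

lemma subst_ev: "subst (ev t p) = ev (subst t) p"
  by (induction p) simp_all

text \<open>\<open>W\<close> contains \<open>s\<close> or its inverse, so the preimage contains the
  variable or its inverse and exceeds the constants; the element \<open>z\<close> keeps it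
  proper.\<close>

lemma valuation_ring_vimage:
  assumes "valuation_ring K W" "range subst \<subseteq> K" "subst z \<notin> W"
  shows "valuation_ring UNIV (subst -` W)"
proof -
  have "var_rf \<in> subst -` W \<or> inverse var_rf \<in> subst -` W"
    using assms(1,2) rangeI[of subst var_rf] by (auto simp: valuation_ring_def)
  then have "subst -` W \<noteq> range const_rf"
    using const_not_var by (metis rangeE)
  moreover have "subst y \<in> K" for y
    using assms(2) by blast
  moreover have "subst -` W \<noteq> UNIV"
    using assms(3) by blast
  ultimately show ?thesis
    using assms by (auto simp: valuation_ring_def)
qed

text \<open>Injectivity makes the substitution an isomorphism onto its range, so strict inclusions
  survive.\<close>

lemma valuation_ring_image:
  assumes "valuation_ring UNIV V"
  shows "valuation_ring (range subst) (subst ` V)"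
proof -
  have "range const_rf \<subset> V" "V \<subset> UNIV"
    using assms by (auto simp: valuation_ring_def)
  then have "subst ` range const_rf \<subset> subst ` V" "subst ` V \<subset> range subst"
    by (metis image_strict_mono inj_subst subset_UNIV inj_on_subset)+
  moreover have "subst ` range const_rf = range const_rf"
    by (simp add: image_image)
  ultimately show ?thesis
    using assms unfolding valuation_ring_def
    by (auto simp flip: subst_diff subst_mult subst_inverse)
qed

lemma nonunits_vimage: "nonunits (subst -` W) = subst -` nonunits W"
  by (auto simp: nonunits_def)

lemma nonunits_image: "nonunits (subst ` V) = subst ` nonunits V"
  by (auto simp: nonunits_def simp flip: subst_inverse)

end

subsection \<open>The rational places\<close>

lemma prime_elem_linear: "prime_elem [:-a, 1 :: 'a :: field:]"
  by (rule prime_elem_linear_field_poly) simp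

lemma nonunit_local_ring_linear: "var_rf - const_rf a \<in> nonunits (local_ring [:-a, 1:])"
  using nonunit_local_ring[OF prime_elem_linear, of a "[:-a,1:]" 1] prime_elem_linear[of a]
  by (simp add: prime_elem_def)

text \<open>\<open>inverse var_rf\<close> has a pole at the place of 0. The resulting substitution
  swaps 0 and infinity, which reduces the point at infinity to a finite one.\<close>

lemma transcendental_inverse_var: "transcendental (inverse (var_rf :: 'a::field poly fract))"
proof -
  interpret valuation "local_ring [:0, 1 :: 'a:]"
    using valuation_local_ring[OF prime_elem_linear[of 0]] by simp
  show ?thesis
    using nonunit_local_ring_linear[of "0::'a"]
    by (intro transcendental_if_not_mem) (simp add: nonunits_def)
qed

interpretation inv: transcendental "inverse var_rf"
  by (rule transcendental_inverse_var)

lemma inv_involution [simp]: "inv.subst (inv.subst z) = z"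
  by (rule rational_function_cases[of z]) (simp add: inv.subst_ev)

fun uniformizer :: "'a::field option \<Rightarrow> 'a poly fract"
  where "uniformizer (Some a) = var_rf - const_rf a"
  | "uniformizer None = inverse var_rf"

definition vr_at :: "'a::field option \<Rightarrow> 'a poly fract set"
  where "vr_at c = (case c of Some a \<Rightarrow> local_ring [:-a, 1:] | None \<Rightarrow> inv.subst -` local_ring [:0, 1:])"

lemma vr_at_Some: "valuation_ring UNIV (vr_at (Some a))"
  using valuation_local_ring[OF prime_elem_linear[of a]] by (simp add: vr_at_def valuation_iff)

lemma valuation_vr_at: "valuation (vr_at c)"
proof (cases c)
  case None
  have "inverse var_rf \<notin> local_ring [:0, 1 :: 'a:]"
    using nonunit_local_ring_linear[of "0::'a"] by (simp add: nonunits_def)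
  then have "valuation_ring UNIV (inv.subst -` local_ring [:0, 1 :: 'a:])"
    using inv.valuation_ring_vimage[OF vr_at_Some[of "0::'a"], of var_rf] by (simp add: vr_at_def)
  with None show ?thesis by (simp add: vr_at_def valuation_iff)
qed (use vr_at_Some in \<open>simp add: valuation_iff\<close>)

lemma uniformizer_nonunit: "uniformizer c \<in> nonunits (vr_at c)"
  using nonunit_local_ring_linear[of "0::'a::field"]
  by (cases c) (auto simp: vr_at_def inv.nonunits_vimage nonunit_local_ring_linear)

text \<open>The residue of \<open>f / g\<close> at a finite point is the value
  \<open>poly f a / poly g a\<close>; infinity is moved to 0 first.\<close>

lemma vr_at_rational:
  assumes "z \<in> vr_at c"
  shows "\<exists>b. z - const_rf b \<in> nonunits (vr_at c)"
proof -
  have Some: "\<exists>b. z - const_rf b \<in> nonunits (local_ring [:-a,1:])"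
    if z: "z \<in> local_ring [:-a,1:]" for z and a :: 'a
  proof -
    interpret valuation "local_ring [:-a, 1:]"
      by (rule valuation_local_ring[OF prime_elem_linear])
    from z obtain f g where fg: "z = ev var_rf f / ev var_rf g" "poly g a \<noteq> 0"
      by (auto simp: local_ring_def poly_eq_0_iff_dvd)
    define b where "b = poly f a / poly g a"
    have "g \<noteq> 0"
      using fg by auto
    then have "z - const_rf b = ev var_rf (f - smult b g) / ev var_rf g"
      using fg by (simp add: field_simps)
    moreover have "[:-a,1:] dvd f - smult b g" "\<not> [:-a,1:] dvd g"
      using fg by (auto simp: b_def poly_eq_0_iff_dvd[symmetric])
    ultimately show ?thesis
      using nonunit_local_ring[OF prime_elem_linear] by metis
  qed
  show ?thesis
  proof (cases c)
    case None
    then have "inv.subst z \<in> local_ring [:-0,1:]"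
      using assms by (simp add: vr_at_def)
    from Some[OF this] show ?thesis
      using None by (simp add: vr_at_def inv.nonunits_vimage)
  qed (use assms Some in \<open>auto simp: vr_at_def\<close>)
qed

context valuation
begin

text \<open>A finite point is the case of a linear prime in \<open>eq_local_ring\<close>. Infinity
  is moved to 0 by the involution, and pulling back a second time returns \<open>V\<close>.\<close>

lemma eq_vr_at: "uniformizer c \<in> nonunits V \<Longrightarrow> V = vr_at c"
proof (cases c)
  case (Some a)
  assume *: "uniformizer c \<in> nonunits V"
  then have "var_rf \<in> V"
    using add_mem[of "var_rf - const_rf a" "const_rf a"] Some nonunit_mem by simp
  moreover have "ev var_rf [:-a,1:] \<in> nonunits V"
    using * Some by simp
  ultimately show ?thesis
    using eq_local_ring prime_elem_imp_irreducible[OF prime_elem_linear] Some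
    by (fastforce simp: vr_at_def)
next
  case None
  assume *: "uniformizer c \<in> nonunits V"
  then have inv: "inverse var_rf \<in> nonunits V"
    using None by simp
  then have "var_rf \<notin> V"
    using mult_nonunit[of var_rf "inverse var_rf"] by auto
  then have "valuation_ring UNIV (inv.subst -` V)"
    using inv.valuation_ring_vimage[OF vr, of "inverse var_rf"] by simp
  then interpret inv: valuation "inv.subst -` V"
    by (simp add: valuation_iff)
  have "var_rf \<in> nonunits (inv.subst -` V)"
    using inv by (simp add: inv.nonunits_vimage)
  then have "inv.subst -` V = local_ring [:0,1:]"
    using prime_elem_imp_irreducible[OF prime_elem_linear[of 0]] nonunit_mem[OF inv] inv
    by (intro inv.eq_local_ring) (auto simp: inv.nonunits_vimage)
  then have "V = inv.subst -` local_ring [:0,1:]"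
    by (metis (no_types, lifting) equalityI inv_involution subsetI vimage_eq)
  then show ?thesis
    using None by (simp add: vr_at_def)
qed

lemma uniformizer_nonunit_iff: "uniformizer c \<in> nonunits V \<longleftrightarrow> V = vr_at c"
  using eq_vr_at uniformizer_nonunit by blast

text \<open>The point is the constant residue of the variable, or infinity if the variable has a
  pole.\<close>

lemma ex_uniformizer_nonunit:
  assumes "\<And>z. z \<in> V \<Longrightarrow> \<exists>b. z - const_rf b \<in> nonunits V"
  obtains c where "V = vr_at c"
proof (cases "var_rf \<in> V")
  case True
  then obtain b where "var_rf - const_rf b \<in> nonunits V"
    using assms by blast
  then show thesis using eq_vr_at[of "Some b"] that by simp
next
  case False
  then show thesis using eq_vr_at[of None] that inverse_nonunit by simp
qed

end

text \<open>Two finite uniformizers differ by a constant, which is a nonunit only when zero; a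
  finite point together with infinity would put both the variable and a nonunit inverse of it into
  one ring.\<close>

lemma inj_vr_at: "inj vr_at"
proof (rule injI)
  fix b c :: "'a option"
  assume eq: "vr_at b = vr_at c"
  interpret valuation "vr_at b" by (rule valuation_vr_at)
  have *: "uniformizer b \<in> nonunits (vr_at b)" "uniformizer c \<in> nonunits (vr_at b)"
    using eq uniformizer_nonunit by metis+
  have **: False if "var_rf - const_rf a \<in> nonunits (vr_at b)" "inverse var_rf \<in> nonunits (vr_at b)" for a
  proof -
    have "var_rf \<in> vr_at b"
      using add_mem[of "var_rf - const_rf a" "const_rf a"] that nonunit_mem by simp
    then show False
      using mult_nonunit[of var_rf "inverse var_rf"] that by simp
  qed
  show "b = c"
  proof (cases b; cases c)
    fix d e assume "b = Some d" "c = Some e"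
    with diff_nonunit[OF *] have "const_rf (e - d) \<in> nonunits (vr_at b)"
      by simp
    then show "b = c"
      using \<open>b = Some d\<close> \<open>c = Some e\<close> unfolding const_nonunit_iff by simp
  qed (use * ** in auto)
qed

lemma nonunits_inject:
  assumes "valuation V" "valuation W" "nonunits V = nonunits W"
  shows "V = W"
  using valuation.mem_iff[OF assms(1)] valuation.mem_iff[OF assms(2)] assms(3) by blast

definition place_at :: "'a::field option \<Rightarrow> 'a poly fract set"
  where "place_at c = nonunits (vr_at c)"

lemma inj_place_at: "inj place_at"
  by (rule injI) (metis place_at_def nonunits_inject valuation_vr_at inj_vr_at injD)

text \<open>Pulling a place back along the embedding gives a rational place of the full field, hence
  a point of the projective line; pushing the place of a point forward reverses this.\<close>

lemma (in transcendental) rational_places_range: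
  "rational_places (range subst) = range (\<lambda>c. subst ` place_at c)"
proof (intro equalityI subsetI)
  fix P assume "P \<in> rational_places (range subst)"
  then obtain V where V: "P = nonunits V" "valuation_ring (range subst) V"
    "\<And>z. z \<in> V \<Longrightarrow> \<exists>c. z - const_rf c \<in> nonunits V"
    by (auto simp: rational_places_def)
  from V(2) obtain z where "subst z \<notin> V"
    by (auto simp: valuation_ring_def)
  with V interpret W: valuation "subst -` V"
    using valuation_ring_vimage by (auto simp: valuation_iff)
  obtain c where "subst -` V = vr_at c"
  proof (rule W.ex_uniformizer_nonunit)
    fix z assume "z \<in> subst -` V"
    with V(3)[of "subst z"] show "\<exists>b. z - const_rf b \<in> nonunits (subst -` V)"
      by (simp add: nonunits_vimage)
  qed
  then have "subst -` P = place_at c"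
    using V by (simp add: place_at_def flip: nonunits_vimage)
  moreover have "P \<subseteq> range subst"
    using V by (auto simp: valuation_ring_def nonunits_def)
  ultimately have "P = subst ` place_at c"
    by blast
  then show "P \<in> range (\<lambda>c. subst ` place_at c)"
    by blast
next
  fix P assume "P \<in> range (\<lambda>c. subst ` place_at c)"
  then obtain c where P: "P = subst ` place_at c"
    by blast
  have "valuation_ring (range subst) (subst ` vr_at c)"
    using valuation_vr_at[of c] by (intro valuation_ring_image) (simp add: valuation_iff)
  moreover have "\<exists>b. z - const_rf b \<in> nonunits (subst ` vr_at c)" if "z \<in> subst ` vr_at c" for z
  proof -
    from that obtain y where y: "y \<in> vr_at c" "z = subst y" by blast
    then obtain b where "y - const_rf b \<in> nonunits (vr_at c)"
      using vr_at_rational by blast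
    then have "subst (y - const_rf b) \<in> subst ` nonunits (vr_at c)"
      by blast
    then show ?thesis
      using y by (auto simp: nonunits_image)
  qed
  ultimately show "P \<in> rational_places (range subst)"
    unfolding rational_places_def P place_at_def nonunits_image[symmetric] by blast
qed

text \<open>Lying over a rational place is tested on one element: the pullback of \<open>W\<close>
  has the uniformizer of \<open>c\<close> as a nonunit, so it is \<open>vr_at c\<close>.\<close>

lemma (in transcendental) place_subset_iff:
  assumes "valuation W"
  shows "subst ` place_at c \<subseteq> nonunits W \<longleftrightarrow> subst (uniformizer c) \<in> nonunits W"
proof
  interpret W: valuation W by fact
  assume *: "subst (uniformizer c) \<in> nonunits W"
  have nz: "uniformizer c \<noteq> 0"
    using const_not_var(1) by (cases c) auto
  \<comment> \<open>This element keeps the pullback of \<open>W\<close> proper.\<close>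
  have "subst (inverse (uniformizer c)) \<notin> W"
    using * nz unfolding subst_inverse by (simp add: nonunits_def)
  then interpret V: valuation "subst -` W"
    using valuation_ring_vimage[OF W.vr] unfolding valuation_iff by blast
  have "subst -` W = vr_at c"
    using * by (intro V.eq_vr_at) (simp add: nonunits_vimage)
  then have "place_at c = subst -` nonunits W"
    by (simp add: place_at_def flip: nonunits_vimage)
  then show "subst ` place_at c \<subseteq> nonunits W"
    by blast
qed (use uniformizer_nonunit in \<open>auto simp: place_at_def\<close>)

subsection \<open>The Galois action\<close>

locale subfield =
  fixes K :: "'b::field set"
  assumes sf: "is_subfield K"
begin

lemma one_mem [simp]: "1 \<in> K"
  and diff_mem: "y \<in> K \<Longrightarrow> z \<in> K \<Longrightarrow> y - z \<in> K"
  and mult_mem: "y \<in> K \<Longrightarrow> z \<in> K \<Longrightarrow> y * z \<in> K"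
  and inverse_mem: "z \<in> K \<Longrightarrow> inverse z \<in> K"
  using sf by (auto simp: is_subfield_def)

lemma zero_mem [simp]: "0 \<in> K"
  using diff_mem[of 1 1] by simp

lemma uminus_mem: "z \<in> K \<Longrightarrow> - z \<in> K"
  using diff_mem[of 0 z] by simp

lemma add_mem: "y \<in> K \<Longrightarrow> z \<in> K \<Longrightarrow> y + z \<in> K"
  using diff_mem[of y "- z"] uminus_mem[of z] by simp

lemma divide_mem: "y \<in> K \<Longrightarrow> z \<in> K \<Longrightarrow> y / z \<in> K"
  using mult_mem[of y "inverse z"] inverse_mem[of z] by (simp add: divide_inverse)

end

lemma is_subfield_const_adjoin: "is_subfield (const_adjoin t)"
  unfolding const_adjoin_def is_subfield_def by blast

lemma const_mem_const_adjoin: "const_rf c \<in> const_adjoin t"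
  and generator_mem_const_adjoin: "t \<in> const_adjoin t"
  unfolding const_adjoin_def by blast+

lemma const_adjoin_least:
  "is_subfield K \<Longrightarrow> range const_rf \<subseteq> K \<Longrightarrow> t \<in> K \<Longrightarrow> const_adjoin t \<subseteq> K"
  unfolding const_adjoin_def by blast

context transcendental
begin

text \<open>Presents the generated subfield as a copy of the rational function field, so that
  \<open>rational_places_range\<close> describes its rational places.\<close>

lemma const_adjoin_eq_range: "const_adjoin s = range subst"
proof
  have "is_subfield (range subst)"
    using rangeI[of subst 1]
    by (auto simp: is_subfield_def simp flip: subst_diff subst_mult subst_inverse)
  moreover have "range const_rf \<subseteq> range subst"
    using subst_const by (metis image_subsetI rangeI)
  moreover have "s \<in> range subst"
    using subst_var by (metis rangeI)
  ultimately show "const_adjoin s \<subseteq> range subst"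
    by (rule const_adjoin_least)
  interpret K: subfield "const_adjoin s"
    by unfold_locales (rule is_subfield_const_adjoin)
  have "ev s p \<in> const_adjoin s" for p
    by (induction p) (auto intro: K.add_mem K.mult_mem const_mem_const_adjoin generator_mem_const_adjoin)
  then have "subst z \<in> const_adjoin s" for z
    by (cases z) (simp add: subst_Fract K.divide_mem)
  then show "range subst \<subseteq> const_adjoin s"
    by blast
qed

text \<open>The fixed elements form a subfield containing the constants and \<open>t\<close>, and
  \<open>const_adjoin t\<close> is the least such.\<close>

lemma fixed_const_adjoin:
  assumes "subst t = t" "z \<in> const_adjoin t"
  shows "subst z = z"
proof -
  have "is_subfield {z. subst z = z}"
    by (simp add: is_subfield_def)
  then have "const_adjoin t \<subseteq> {z. subst z = z}"
    using assms(1) by (intro const_adjoin_least) auto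
  with assms(2) show ?thesis by blast
qed

end

section \<open>The cubic function and its poles\<close>

locale cubic =
  fixes w :: "'a::field"
  assumes w: "w \<noteq> 0"
begin

abbreviation X :: "'a poly fract" where "X \<equiv> var_rf"
abbreviation c :: "'a poly fract" where "c \<equiv> const_rf w"

definition h :: "'a poly fract"
  where "h = (X ^ 3 - 3 * c ^ 2 * X + c ^ 3) / (X * (X - c))"

lemma nz: "X \<noteq> 0" "X - c \<noteq> 0" "c - X \<noteq> 0" "c \<noteq> 0" "X \<noteq> c" "c \<noteq> X"
  using const_not_var(1)[of w] w by auto

lemma num_nz: "X ^ 3 - 3 * c ^ 2 * X + c ^ 3 \<noteq> 0"
proof -
  have "ev X [:w^3, -3*w^2, 0, 1:] \<noteq> 0"
    unfolding ev_var_eq_0_iff by simp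
  then show ?thesis
    by (simp add: algebra_simps power2_eq_square power3_eq_cube)
qed

lemma h_nz: "h \<noteq> 0"
  using nz num_nz by (simp add: h_def)

text \<open>The numerator is congruent to \<open>w ^ 3\<close> modulo \<open>X\<close> and to
  \<open>- (w ^ 3)\<close> modulo \<open>X - c\<close>, so it is a unit where the denominator
  vanishes.\<close>

lemma inverse_h_nonunit_if:
  assumes "valuation V" "X \<in> V" "X \<in> nonunits V \<or> X - c \<in> nonunits V"
  shows "inverse h \<in> nonunits V"
proof -
  interpret valuation V by fact
  let ?N = "X ^ 3 - 3 * c ^ 2 * X + c ^ 3"
  have mem: "X \<in> V" "X - c \<in> V" "?N \<in> V"
    using assms(2) const_mem[of "3 * w^2"] const_mem[of "w^3"]
    by (auto intro!: add_mem diff_mem mult_mem power_mem)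
  have "?N \<notin> nonunits V"
  proof
    assume N: "?N \<in> nonunits V"
    show False
      using assms(3)
    proof
      assume *: "X \<in> nonunits V"
      have "?N - X * (X ^ 2 - const_rf (3 * w ^ 2)) = const_rf (w ^ 3)"
        by (simp add: algebra_simps power2_eq_square power3_eq_cube)
      moreover have "X * (X ^ 2 - const_rf (3 * w ^ 2)) \<in> nonunits V"
        using mem by (intro mult_nonunit' * diff_mem power_mem const_mem)
      ultimately have "const_rf (w ^ 3) \<in> nonunits V"
        using diff_nonunit[OF N] by metis
      then show False using w unfolding const_nonunit_iff by simp
    next
      assume *: "X - c \<in> nonunits V"
      have "?N - (X - c) * (X ^ 2 + c * X - const_rf (2 * w ^ 2)) = const_rf (- (w ^ 3))"
        by (simp add: algebra_simps power2_eq_square power3_eq_cube)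
      moreover have "(X - c) * (X ^ 2 + c * X - const_rf (2 * w ^ 2)) \<in> nonunits V"
        using mem by (intro mult_nonunit' * diff_mem add_mem mult_mem power_mem const_mem)
      ultimately have "const_rf (- (w ^ 3)) \<in> nonunits V"
        using diff_nonunit[OF N] by metis
      then show False using w unfolding const_nonunit_iff by simp
    qed
  qed
  then have "X * (X - c) * inverse ?N \<in> nonunits V"
    using assms(3) mem by (intro mult_nonunit'[of "X * (X - c)"] inverse_mem) (simp_all add: nonunit_mult_iff)
  then show ?thesis
    by (simp add: h_def divide_inverse mult_ac)
qed

text \<open>Dividing the numerator by \<open>X ^ 3\<close> and expanding in
  \<open>y = inverse X\<close> gives an element congruent to 1, hence a unit, while a factor
  \<open>y\<close> of \<open>inverse h\<close> remains.\<close>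

lemma inverse_h_nonunit_if_pole:
  assumes "valuation V" "X \<notin> V"
  shows "inverse h \<in> nonunits V"
proof -
  interpret valuation V by fact
  define y where "y = inverse X"
  have y: "y \<in> nonunits V" "y \<in> V"
    using assms(2) inverse_nonunit nonunit_mem by (auto simp: y_def)
  define N where "N = X ^ 3 - 3 * c ^ 2 * X + c ^ 3"
  let ?D = "1 + y * (const_rf (w ^ 3) * y ^ 2 - const_rf (3 * w ^ 2) * y)"
  have "y * (const_rf (w ^ 3) * y ^ 2 - const_rf (3 * w ^ 2) * y) \<in> nonunits V"
    using y by (intro mult_nonunit' y diff_mem mult_mem const_mem power_mem)
  then have D: "?D \<notin> nonunits V" "?D \<in> V"
    using nonunit_mem by (auto simp: unit_add_iff intro!: add_mem)
  have D_eq: "?D = N / X ^ 3"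
    using nz by (simp add: N_def y_def field_simps power2_eq_square power3_eq_cube)
  have "inverse h = y * ((1 - c * y) * inverse (N / X ^ 3))"
    using nz num_nz unfolding h_def y_def N_def[symmetric]
    by (simp add: field_simps power3_eq_cube)
  then have "inverse h = y * ((1 - c * y) * inverse ?D)"
    by (simp only: D_eq)
  moreover have "y * ((1 - c * y) * inverse ?D) \<in> nonunits V"
    using D y by (intro mult_nonunit' y mult_mem diff_mem inverse_mem) auto
  ultimately show ?thesis by simp
qed

text \<open>When \<open>X\<close> is in \<open>V\<close>, multiplying \<open>inverse h\<close> by
  the numerator leaves \<open>X * (X - c)\<close>, and a place is a prime ideal.\<close>

lemma inverse_h_nonunit_iff:
  assumes "valuation V"
  shows "inverse h \<in> nonunits V \<longleftrightarrow> V \<in> {vr_at None, vr_at (Some 0), vr_at (Some w)}"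
proof -
  interpret valuation V by fact
  have X: "X \<in> V" if "X - const_rf a \<in> nonunits V" for a
    using add_mem[of "X - const_rf a" "const_rf a"] that nonunit_mem by simp
  have "inverse h \<in> nonunits V \<longleftrightarrow> inverse X \<in> nonunits V \<or> X \<in> nonunits V \<or> X - c \<in> nonunits V"
  proof
    assume *: "inverse h \<in> nonunits V"
    show "inverse X \<in> nonunits V \<or> X \<in> nonunits V \<or> X - c \<in> nonunits V"
    proof (cases "X \<in> V")
      case True
      then have "X ^ 3 - 3 * c ^ 2 * X + c ^ 3 \<in> V"
        using const_mem[of "3 * w^2"] const_mem[of "w^3"]
        by (auto intro!: add_mem diff_mem mult_mem power_mem)
      then have "(X ^ 3 - 3 * c ^ 2 * X + c ^ 3) * inverse h \<in> nonunits V"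
        using * by (intro mult_nonunit)
      moreover have "(X ^ 3 - 3 * c ^ 2 * X + c ^ 3) * inverse h = X * (X - c)"
        using num_nz nz by (simp add: h_def)
      ultimately show ?thesis
        using True by (simp add: nonunit_mult_iff diff_mem)
    qed (use inverse_nonunit in blast)
  next
    assume "inverse X \<in> nonunits V \<or> X \<in> nonunits V \<or> X - c \<in> nonunits V"
    then consider "inverse X \<in> nonunits V" | "X \<in> nonunits V" | "X - c \<in> nonunits V"
      by blast
    then show "inverse h \<in> nonunits V"
    proof cases
      case 1
      then have "X \<notin> V"
        using mult_nonunit[of X "inverse X"] nz by auto
      then show ?thesis using inverse_h_nonunit_if_pole[OF assms] by blast
    qed (use inverse_h_nonunit_if[OF assms] X nonunit_mem in blast)+
  qed
  then show ?thesis
    using uniformizer_nonunit_iff[of None] uniformizer_nonunit_iff[of "Some 0"]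
      uniformizer_nonunit_iff[of "Some w"] by simp
qed

lemma transcendental_h: "transcendental h"
proof -
  interpret valuation "vr_at (Some (0::'a))"
    by (rule valuation_vr_at)
  have "inverse h \<in> nonunits (vr_at (Some (0::'a)))"
    using inverse_h_nonunit_iff[OF valuation_vr_at] by blast
  then show ?thesis
    using h_nz by (intro transcendental_if_not_mem) (simp add: nonunits_def)
qed

sublocale h: transcendental h
  by (rule transcendental_h)

section \<open>The automorphism of order three\<close>

definition sg :: "'a poly fract" where "sg = c ^ 2 / (c - X)"

text \<open>\<open>sg\<close> has a pole at the place of \<open>w\<close>.\<close>

lemma transcendental_sg: "transcendental sg"
proof -
  interpret valuation "vr_at (Some w)"
    by (rule valuation_vr_at)
  have "sg \<noteq> 0"
    using nz by (simp add: sg_def)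
  have "X - c \<in> nonunits (vr_at (Some w))"
    using uniformizer_nonunit[of "Some w"] by simp
  then have "const_rf (- inverse (w ^ 2)) * (X - c) \<in> nonunits (vr_at (Some w))"
    by (intro mult_nonunit const_mem)
  moreover have "const_rf (- inverse (w ^ 2)) * (X - c) = inverse sg"
    using nz by (simp add: sg_def field_simps)
  ultimately have "inverse sg \<in> nonunits (vr_at (Some w))"
    by metis
  then show ?thesis
    using \<open>sg \<noteq> 0\<close> by (intro transcendental_if_not_mem) (simp add: nonunits_def)
qed

sublocale sg: transcendental sg
  by (rule transcendental_sg)

abbreviation \<sigma> where "\<sigma> \<equiv> sg.subst"

lemma \<sigma>_sg: "\<sigma> sg = c * (X - c) / X"
proof -
  have "c - sg \<noteq> 0"
    using nz by (simp add: sg_def field_simps power2_eq_square)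
  have "\<sigma> sg = c ^ 2 / (c - sg)"
    using sg.subst_divide[of "c ^ 2" "c - X"] by (simp add: sg_def[symmetric])
  also have "\<dots> = c * (X - c) / X"
    using nz \<open>c - sg \<noteq> 0\<close> by (simp add: sg_def divide_simps) (simp add: algebra_simps power2_eq_square)
  finally show ?thesis .
qed

lemma \<sigma>_\<sigma>_sg: "\<sigma> (\<sigma> sg) = X"
proof -
  have "\<sigma> (\<sigma> sg) = c * (sg - c) / sg"
    unfolding \<sigma>_sg by simp
  also have "\<dots> = X"
    using nz by (simp add: sg_def divide_simps) (simp add: algebra_simps power2_eq_square)
  finally show ?thesis .
qed

lemma \<sigma>_cubed [simp]: "\<sigma> (\<sigma> (\<sigma> z)) = z"
  by (rule rational_function_cases[of z]) (simp add: sg.subst_ev \<sigma>_\<sigma>_sg)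

lemma h_eq_trace: "h = X + sg + \<sigma> sg"
proof -
  have "h = X + sg + c * (X - c) / X"
    unfolding h_def sg_def using nz
    by (simp add: divide_simps) (simp add: algebra_simps power2_eq_square power3_eq_cube)
  then show ?thesis
    by (simp only: \<sigma>_sg)
qed

lemma \<sigma>_h [simp]: "\<sigma> h = h"
  unfolding h_eq_trace by (simp add: \<sigma>_\<sigma>_sg)

section \<open>The fixed field of the automorphism\<close>

abbreviation K where "K \<equiv> const_adjoin h"

sublocale K: subfield K
  by unfold_locales (rule is_subfield_const_adjoin)

lemma \<sigma>_fixes_K: "z \<in> K \<Longrightarrow> \<sigma> z = z"
  by (rule sg.fixed_const_adjoin[OF \<sigma>_h])

text \<open>The \<open>K\<close>-span of 1, \<open>X\<close> and \<open>X ^ 2\<close>. Reduction by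
  the cubic relation \<open>min_poly\<close> makes it a ring.\<close>

definition R where "R = {a + b * X + d * X ^ 2 | a b d. a \<in> K \<and> b \<in> K \<and> d \<in> K}"

lemma RI: "a \<in> K \<Longrightarrow> b \<in> K \<Longrightarrow> d \<in> K \<Longrightarrow> a + b * X + d * X ^ 2 \<in> R"
  by (auto simp: R_def)

lemma R_add: "y \<in> R \<Longrightarrow> z \<in> R \<Longrightarrow> y + z \<in> R"
proof -
  assume "y \<in> R" "z \<in> R"
  then obtain a b d a' b' d' where *: "a \<in> K" "b \<in> K" "d \<in> K" "a' \<in> K" "b' \<in> K" "d' \<in> K"
    "y = a + b * X + d * X ^ 2" "z = a' + b' * X + d' * X ^ 2"
    unfolding R_def by blast
  have eq: "y + z = (a + a') + (b + b') * X + (d + d') * X ^ 2"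
    unfolding * by (simp add: algebra_simps)
  show ?thesis
    unfolding eq using * by (intro RI K.add_mem)
qed

lemma R_scale: "k \<in> K \<Longrightarrow> z \<in> R \<Longrightarrow> k * z \<in> R"
proof -
  assume k: "k \<in> K" and "z \<in> R"
  then obtain a b d where *: "a \<in> K" "b \<in> K" "d \<in> K" "z = a + b * X + d * X ^ 2"
    unfolding R_def by blast
  have eq: "k * z = k * a + (k * b) * X + (k * d) * X ^ 2"
    unfolding * by (simp add: algebra_simps)
  show ?thesis
    unfolding eq using * k by (intro RI K.mult_mem)
qed

lemma K_const: "const_rf a \<in> K"
  by (rule const_mem_const_adjoin)

lemma K_h: "h \<in> K"
  by (rule generator_mem_const_adjoin)

text \<open>The definition of \<open>h\<close> with its denominator cleared is a monic cubic
  relation for \<open>X\<close> over \<open>K\<close>.\<close>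

lemma min_poly: "X ^ 3 = h * X ^ 2 + (3 * c ^ 2 - h * c) * X - c ^ 3"
proof -
  have "h * (X * (X - c)) = X ^ 3 - 3 * c ^ 2 * X + c ^ 3"
    using nz by (simp add: h_def)
  then show ?thesis
    by (simp add: algebra_simps power2_eq_square)
qed

lemma R_X: "z \<in> R \<Longrightarrow> X * z \<in> R"
proof -
  assume "z \<in> R"
  then obtain a b d where *: "a \<in> K" "b \<in> K" "d \<in> K" "z = a + b * X + d * X ^ 2"
    unfolding R_def by blast
  have "X * z = a * X + b * X ^ 2 + d * X ^ 3"
    unfolding * by (simp add: algebra_simps power2_eq_square power3_eq_cube)
  also have "\<dots> = d * const_rf (- (w ^ 3)) + (a + d * (const_rf (3 * w ^ 2) - h * c)) * X + (b + d * h) * X ^ 2"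
    unfolding min_poly by (simp add: algebra_simps)
  finally have eq: "X * z = \<dots>" .
  show ?thesis
    unfolding eq using * by (intro RI K.mult_mem K.add_mem K.diff_mem K_h K_const)
qed

lemma R_mult: "y \<in> R \<Longrightarrow> z \<in> R \<Longrightarrow> y * z \<in> R"
proof -
  assume "y \<in> R" and z: "z \<in> R"
  then obtain a b d where *: "a \<in> K" "b \<in> K" "d \<in> K" "y = a + b * X + d * X ^ 2"
    unfolding R_def by blast
  have eq: "y * z = a * z + b * (X * z) + d * (X * (X * z))"
    unfolding * by (simp add: algebra_simps power2_eq_square)
  show ?thesis
    unfolding eq using * z by (intro R_add R_scale R_X)
qed

lemma K_subset_R: "k \<in> K \<Longrightarrow> k \<in> R"
  using RI[of k 0 0] by simp

lemma X_R: "X \<in> R"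
  using RI[of 0 1 0] by simp

lemma ev_R: "s \<in> R \<Longrightarrow> ev s p \<in> R"
  by (induction p) (auto intro!: R_add R_mult intro: K_subset_R K_const)

text \<open>
  Polynomial division of the minimal polynomial of \<open>X\<close> over \<open>K\<close> by \<open>X - c\<close> leaves the remainder
  \<open>- c ^ 3\<close>, which exhibits \<open>1 / (X - c)\<close> as a polynomial in \<open>X\<close>.
\<close>

lemma sg_R: "sg \<in> R"
proof -
  define k where "k = X ^ 2 + (c - h) * X - 2 * c ^ 2"
  have "(X - c) * k = c ^ 3"
    using min_poly by (simp add: k_def algebra_simps power2_eq_square power3_eq_cube)
  then have "c ^ 2 * c = - k * (c - X)"
    by (simp add: algebra_simps power2_eq_square power3_eq_cube)
  then have "sg = - k / c"
    unfolding sg_def using nz frac_eq_eq[of "c - X" c "c ^ 2" "- k"] by blast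
  also have "\<dots> = const_rf (2 * w) + (h - c) / c * X + - inverse c * X ^ 2"
    using nz by (simp add: k_def field_simps power2_eq_square)
  finally have eq: "sg = \<dots>" .
  show ?thesis
    unfolding eq by (intro RI K.divide_mem K.diff_mem K.uminus_mem K.inverse_mem K_h K_const)
qed

text \<open>The trace \<open>h\<close> is in \<open>K\<close>, so the third conjugate is determined
  by the other two.\<close>

lemma \<sigma>_sg_R: "\<sigma> sg \<in> R"
proof -
  have eq: "\<sigma> sg = h + (- 1) * (X + sg)"
    using h_eq_trace by (simp add: algebra_simps)
  show ?thesis
    unfolding eq using K_h K.uminus_mem[of 1]
    by (intro R_add R_scale X_R sg_R) (auto intro: K_subset_R)
qed

text \<open>The difference of \<open>z\<close> and its conjugate has the factor
  \<open>X - sg\<close>, leaving \<open>b + d * (X + sg) = 0\<close>. Subtracting the conjugate of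
  this relation forces \<open>d = 0\<close>, and then \<open>b = 0\<close>.\<close>

lemma fixed_R_imp_K:
  assumes "z \<in> R" "\<sigma> z = z"
  shows "z \<in> K"
proof -
  obtain a b d where *: "a \<in> K" "b \<in> K" "d \<in> K" "z = a + b * X + d * X ^ 2"
    using assms(1) unfolding R_def by blast
  have ne: "X \<noteq> sg"
  proof
    assume "X = sg"
    \<comment> \<open>The fixed-point equation \<open>X * (c - X) = c ^ 2\<close>, a nontrivial
      polynomial relation for \<open>X\<close>.\<close>
    then have "ev X [:w^2, -w, 1:] = 0"
      using nz by (simp add: sg_def field_simps power2_eq_square)
    then show False
      unfolding ev_var_eq_0_iff by simp
  qed
  have "a + b * sg + d * sg ^ 2 = a + b * X + d * X ^ 2"
    using assms(2) unfolding * by (simp add: \<sigma>_fixes_K *)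
  then have "(b + d * (X + sg)) * (X - sg) = 0"
    by (simp add: algebra_simps power2_eq_square)
  then have 1: "b + d * (X + sg) = 0"
    using ne by simp
  then have "\<sigma> (b + d * (X + sg)) = 0"
    by simp
  then have "b + d * (sg + \<sigma> sg) = 0"
    by (simp add: \<sigma>_fixes_K *)
  moreover have "d * (X - \<sigma> sg) = (b + d * (X + sg)) - (b + d * (sg + \<sigma> sg))"
    by (simp add: algebra_simps)
  ultimately have "d * (X - \<sigma> sg) = 0"
    using 1 by simp
  moreover have "X \<noteq> \<sigma> sg"
    using ne \<sigma>_\<sigma>_sg by (metis sg.subst_var \<sigma>_cubed)
  ultimately have "d = 0"
    by simp
  with 1 * show ?thesis
    by simp
qed

text \<open>The denominator is replaced by its norm \<open>N\<close>, the product of its three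
  conjugates. Both \<open>N\<close> and \<open>z * N\<close> are fixed elements of
  \<open>R\<close>.\<close>

lemma fixed_imp_K:
  assumes "\<sigma> z = z"
  shows "z \<in> K"
proof -
  obtain f g where fg: "g \<noteq> 0" "z = ev X f / ev X g"
    by (rule rational_function_cases)
  define N where "N = ev X g * ev sg g * ev (\<sigma> sg) g"
  have N: "\<sigma> N = N" "N \<noteq> 0"
    using fg(1) sg.subst_eq_0_iff[of "ev sg g"]
    by (simp_all add: N_def sg.subst_ev \<sigma>_\<sigma>_sg mult.commute mult.left_commute)
  have zN: "z * N = ev X f * ev sg g * ev (\<sigma> sg) g"
    using fg by (simp add: N_def)
  have "N \<in> R" "z * N \<in> R"
    unfolding zN by (simp_all add: N_def R_mult ev_R X_R sg_R \<sigma>_sg_R)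
  then have "N \<in> K" "z * N \<in> K"
    using N assms by (auto intro!: fixed_R_imp_K)
  then show ?thesis
    using K.divide_mem[of "z * N" N] N by simp
qed

lemma K_iff: "z \<in> K \<longleftrightarrow> \<sigma> z = z"
  using fixed_imp_K \<sigma>_fixes_K by blast

lemma galois_over_K: "galois_over K"
  unfolding galois_over_def
proof (intro conjI allI)
  show "is_subfield K"
    by (rule K.sf)
  fix z
  \<comment> \<open>The product of the three linear factors at the conjugates of \<open>z\<close>;
    its coefficients are symmetric in them, hence fixed.\<close>
  define p where "p = [:- (z * \<sigma> z * \<sigma> (\<sigma> z)), z * \<sigma> z + z * \<sigma> (\<sigma> z) + \<sigma> z * \<sigma> (\<sigma> z),
    - (z + \<sigma> z + \<sigma> (\<sigma> z)), 1:]"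
  have "p \<noteq> 0"
    by (simp add: p_def)
  moreover have "coeff p i \<in> K" for i
    by (auto simp: p_def coeff_pCons K_iff algebra_simps split: nat.splits)
  moreover have "poly p z = 0"
    by (simp add: p_def algebra_simps)
  ultimately show "\<exists>p. p \<noteq> 0 \<and> (\<forall>i. coeff p i \<in> K) \<and> poly p z = 0"
    by blast
next
  \<comment> \<open>The single automorphism \<open>\<sigma>\<close> already cuts the fixed field
    down to \<open>K\<close>.\<close>
  have "bij \<sigma>"
    by (rule o_bij[of "\<lambda>z. \<sigma> (\<sigma> z)"]) auto
  then have "\<sigma> \<in> field_auts_fixing K"
    by (simp add: field_auts_fixing_def \<sigma>_fixes_K)
  then show "{z. \<forall>\<tau>\<in>field_auts_fixing K. \<tau> z = z} = K"
    using fixed_imp_K by (auto simp: field_auts_fixing_def)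
qed

end

subsection \<open>The fibres of the rational function\<close>

lemma places_UNIV: "places UNIV = {nonunits V | V. valuation V}"
  by (simp add: places_def valuation_iff)

text \<open>A factorization into nonconstant parts would have a linear factor, and that has a
  root.\<close>

lemma irreducible_cubic:
  fixes p :: "'a::field poly"
  assumes "degree p = 3" "\<And>a. poly p a \<noteq> 0"
  shows "irreducible p"
proof (rule irreducibleI)
  show "p \<noteq> 0"
    using assms(1) by auto
  then show "\<not> p dvd 1"
    using assms(1) by (simp add: is_unit_iff_degree)
  fix f g assume p: "p = f * g"
  have no_linear: "degree q \<noteq> 1" if "q dvd p" for q
  proof
    assume "degree q = 1"
    then obtain a b where "q = [:a, b:]" "b \<noteq> 0"
      by (metis degree_pCons_eq_if degree_eq_zeroE pCons_cases One_nat_def one_neq_zero Suc_inject degree_0 pCons_eq_0_iff)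
    then have "poly q (- a / b) = 0"
      by simp
    then show False
      using that assms(2) by (metis dvd_def mult_zero_left poly_mult)
  qed
  have "f \<noteq> 0" "g \<noteq> 0"
    using \<open>p \<noteq> 0\<close> p by auto
  then have "degree f + degree g = 3"
    using p assms(1) by (simp add: degree_mult_eq)
  moreover have "degree f \<noteq> 1" "degree g \<noteq> 1"
    using no_linear p by simp_all
  ultimately have "degree f = 0 \<or> degree g = 0"
    by linarith
  then show "f dvd 1 \<or> g dvd 1"
    using \<open>f \<noteq> 0\<close> \<open>g \<noteq> 0\<close> by (simp add: is_unit_iff_degree)
qed

context cubic
begin

text \<open>The value of \<open>sg\<close> at a point of the projective line.\<close>

fun s :: "'a option \<Rightarrow> 'a option"
  where "s None = Some 0"
  | "s (Some a) = (if a = w then None else Some (w ^ 2 / (w - a)))"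

text \<open>The evaluation of \<open>h\<close> written as an orbit sum, identified with
  \<open>rf_eval h\<close> in \<open>rf_eval_h\<close>. The poles infinity, 0 and \<open>w\<close>
  form one orbit of \<open>s\<close>.\<close>

fun H :: "'a option \<Rightarrow> 'a option"
  where "H None = None"
  | "H (Some a) = (if a = 0 \<or> a = w then None else Some (a + w ^ 2 / (w - a) + w * (a - w) / a))"

lemma s_s: "a \<noteq> 0 \<Longrightarrow> a \<noteq> w \<Longrightarrow> s (s (Some a)) = Some (w * (a - w) / a)"
  using w by (auto simp: divide_simps) (simp_all add: algebra_simps power2_eq_square)

lemma s_cubed [simp]: "s (s (s P)) = P"
proof (cases P)
  case (Some a)
  show ?thesis
  proof (cases "a = 0 \<or> a = w")
    case False
    then have a: "a \<noteq> 0" "a \<noteq> w"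
      by auto
    then have ne: "w * (a - w) / a \<noteq> w"
      using w by (simp add: field_simps)
    have "w - w * (a - w) / a = w ^ 2 / a"
      using a by (simp add: field_simps power2_eq_square)
    then have "w ^ 2 / (w - w * (a - w) / a) = a"
      using a w by simp
    with ne show ?thesis
      unfolding Some s_s[OF a] by simp
  qed (use w Some in \<open>auto simp: power2_eq_square\<close>)
qed (use w in \<open>simp add: power2_eq_square\<close>)

text \<open>Vieta's formulas for the orbit \<open>a\<close>, \<open>a1\<close>, \<open>a2\<close>;
  the cubic is the numerator of \<open>h - b\<close>.\<close>

lemma H_Some_eq:
  assumes "a \<noteq> 0" "a \<noteq> w" "H (Some a) = Some b"
  defines "a1 \<equiv> w ^ 2 / (w - a)" and "a2 \<equiv> w * (a - w) / a"
  shows "[:w ^ 3, b * w - 3 * w ^ 2, - b, 1:] = [:- a, 1:] * [:- a1, 1:] * [:- a2, 1:]"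
proof -
  have "b = a + a1 + a2"
    using assms by simp
  moreover have "b * w - 3 * w ^ 2 = a * a1 + a * a2 + a1 * a2"
    using assms(1,2) unfolding calculation a1_def a2_def
    by (simp add: divide_simps) (simp add: algebra_simps power2_eq_square power3_eq_cube)
  moreover have "w ^ 3 = - (a * a1 * a2)"
    using assms(1,2) unfolding a1_def a2_def
    by (simp add: divide_simps) (simp add: algebra_simps power2_eq_square power3_eq_cube)
  ultimately show ?thesis
    by (simp add: algebra_simps)
qed

lemma ev_linear: "ev y [:- a, 1:] = y - const_rf a"
  by simp

lemma h_diff_eq: "h - const_rf b = ev X [:w ^ 3, b * w - 3 * w ^ 2, - b, 1:] / (X * (X - c))"
proof -
  define D where "D = X * (X - c)"
  have eq: "ev X [:w ^ 3, b * w - 3 * w ^ 2, - b, 1:] = X ^ 3 - 3 * c ^ 2 * X + c ^ 3 - const_rf b * D"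
    by (simp add: D_def algebra_simps power2_eq_square power3_eq_cube)
  have "D \<noteq> 0"
    using nz by (simp add: D_def)
  then show ?thesis
    unfolding h_def D_def[symmetric] eq by (simp add: diff_divide_distrib)
qed

lemma X_unit:
  assumes "valuation V" "X - const_rf a \<in> nonunits V" "a \<noteq> 0" "a \<noteq> w"
  shows "X \<in> V" "X \<notin> nonunits V" "X - c \<notin> nonunits V"
proof -
  interpret valuation V by fact
  show "X \<in> V"
    using add_mem[of "X - const_rf a" "const_rf a"] assms(2) nonunit_mem by simp
  show "X \<notin> nonunits V"
    using unit_add_iff[OF assms(2), of "const_rf a"] assms(3) by simp
  show "X - c \<notin> nonunits V"
    using unit_add_iff[OF assms(2), of "const_rf (a - w)"] assms(4)
    unfolding const_nonunit_iff by simp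
qed

text \<open>The numerator of \<open>h - b\<close> has the factor \<open>X - a\<close>, and its
  denominator is a unit at \<open>a\<close>.\<close>

lemma h_residue:
  assumes "valuation V" "X - const_rf a \<in> nonunits V" "a \<noteq> 0" "a \<noteq> w" "H (Some a) = Some b"
  shows "h - const_rf b \<in> nonunits V"
proof -
  interpret valuation V by fact
  note X = X_unit[OF assms(1-4)]
  have "ev X [:w ^ 3, b * w - 3 * w ^ 2, - b, 1:]
    = ev X [:- a, 1:] * ev X ([:- (w ^ 2 / (w - a)), 1:] * [:- (w * (a - w) / a), 1:])"
    unfolding H_Some_eq[OF assms(3-5)] ev_mult by (simp only: mult.assoc)
  also have "\<dots> \<in> nonunits V"
    using assms(2) X by (intro mult_nonunit' ev_mem) simp_all
  finally have "ev X [:w ^ 3, b * w - 3 * w ^ 2, - b, 1:] * (inverse X * inverse (X - c)) \<in> nonunits V"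
    using X by (intro mult_nonunit'[of "ev X p" for p] mult_mem inverse_mem diff_mem const_mem)
  then show ?thesis
    unfolding h_diff_eq by (simp add: divide_inverse)
qed

text \<open>A pole of \<open>X\<close> would be a pole of \<open>h\<close>, although
  \<open>h\<close> is congruent to a constant. With \<open>X\<close> in \<open>V\<close>, the
  denominator of \<open>h - b\<close> can be multiplied away.\<close>

lemma h_residue_imp:
  assumes "valuation V" "h - const_rf b \<in> nonunits V"
  shows "X \<in> V" "ev X [:w ^ 3, b * w - 3 * w ^ 2, - b, 1:] \<in> nonunits V"
proof -
  interpret valuation V by fact
  show X: "X \<in> V"
  proof (rule ccontr)
    assume "X \<notin> V"
    then have *: "inverse h \<in> nonunits V"
      by (rule inverse_h_nonunit_if_pole[OF assms(1)])
    have "h \<in> V"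
      using add_mem[of "h - const_rf b" "const_rf b"] assms(2) nonunit_mem by simp
    then show False
      using mult_nonunit[OF _ *, of h] h_nz by simp
  qed
  have "(h - const_rf b) * (X * (X - c)) \<in> nonunits V"
    using X assms(2) by (intro mult_nonunit' mult_mem diff_mem const_mem)
  moreover have "(h - const_rf b) * (X * (X - c)) = ev X [:w ^ 3, b * w - 3 * w ^ 2, - b, 1:]"
    unfolding h_diff_eq using nz by simp
  ultimately show "ev X [:w ^ 3, b * w - 3 * w ^ 2, - b, 1:] \<in> nonunits V"
    by simp
qed

text \<open>By \<open>place_subset_iff\<close>, these are the places above the rational place of
  \<open>K\<close> that belongs to \<open>b\<close>.\<close>

definition places_over :: "'a option \<Rightarrow> 'a poly fract set set"
  where "places_over b = {Q \<in> places UNIV. h.subst (uniformizer b) \<in> Q}"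

lemma places_over_iff:
  assumes "valuation V"
  shows "nonunits V \<in> places_over b \<longleftrightarrow> h.subst (uniformizer b) \<in> nonunits V"
  using assms by (auto simp: places_over_def places_UNIV)

lemma subst_uniformizer: "h.subst (uniformizer b) = (case b of None \<Rightarrow> inverse h | Some b \<Rightarrow> h - const_rf b)"
  by (cases b) simp_all

lemma places_over_subset: "P \<in> places_over b \<Longrightarrow> \<exists>V. valuation V \<and> P = nonunits V"
  by (auto simp: places_over_def places_UNIV)

lemma place_at_in_places_over: "place_at P \<in> places_over (H P)"
proof -
  interpret valuation "vr_at P" by (rule valuation_vr_at)
  note un = uniformizer_nonunit[of P]
  show ?thesis
    unfolding place_at_def places_over_iff[OF valuation_vr_at] subst_uniformizer
  proof (cases "P \<in> {None, Some 0, Some w}")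
    case True
    then have "inverse h \<in> nonunits (vr_at P)"
      using inverse_h_nonunit_iff[OF valuation_vr_at[of P]] by blast
    then show "(case H P of None \<Rightarrow> inverse h | Some b \<Rightarrow> h - const_rf b) \<in> nonunits (vr_at P)"
      using True w by auto
  next
    case False
    then obtain a where P: "P = Some a" "a \<noteq> 0" "a \<noteq> w"
      by (cases P) auto
    then obtain b where b: "H (Some a) = Some b"
      by simp
    show "(case H P of None \<Rightarrow> inverse h | Some b \<Rightarrow> h - const_rf b) \<in> nonunits (vr_at P)"
      using h_residue[OF valuation_vr_at[of P] _ P(2,3) b] un unfolding P(1) b by simp
  qed
qed

text \<open>Outside the poles the numerator of \<open>h - b\<close> is a product of the uniformizers
  at the three orbit points, and a place, being prime, contains one of them.\<close>

lemma places_over_H: "places_over (H P) \<subseteq> place_at ` {P, s P, s (s P)}"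
proof
  fix Q assume Q: "Q \<in> places_over (H P)"
  then obtain V where V: "valuation V" "Q = nonunits V"
    using places_over_subset by blast
  interpret valuation V by fact
  show "Q \<in> place_at ` {P, s P, s (s P)}"
  proof (cases "P \<in> {None, Some 0, Some w}")
    case True
    then have "{P, s P, s (s P)} = {None, Some 0, Some w}"
      using w by (auto simp: power2_eq_square)
    moreover have "inverse h \<in> nonunits V"
      using Q True unfolding V(2) places_over_iff[OF V(1)] subst_uniformizer by auto
    ultimately show ?thesis
      using inverse_h_nonunit_iff[OF V(1)] V(2) by (auto simp: place_at_def)
  next
    case False
    then obtain a where P: "P = Some a" "a \<noteq> 0" "a \<noteq> w"
      by (cases P) auto
    then obtain b where b: "H (Some a) = Some b"
      by simp
    have "h - const_rf b \<in> nonunits V"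
      using Q unfolding V(2) places_over_iff[OF V(1)] subst_uniformizer P b by simp
    note * = h_residue_imp[OF V(1) this]
    note **[simp] = diff_mem[OF *(1) const_mem]
    have "(X - const_rf a) * (X - const_rf (w ^ 2 / (w - a))) * (X - const_rf (w * (a - w) / a)) \<in> nonunits V"
      using *(2) unfolding H_Some_eq[OF P(2,3) b] ev_mult ev_linear .
    then have "X - const_rf a \<in> nonunits V \<or> X - const_rf (w ^ 2 / (w - a)) \<in> nonunits V
      \<or> X - const_rf (w * (a - w) / a) \<in> nonunits V"
      by (simp add: nonunit_mult_iff mult_mem del: const_rf_simps)
    then have "\<exists>P'\<in>{P, s P, s (s P)}. uniformizer P' \<in> nonunits V"
      using P s_s[OF P(2,3)] by auto
    then show ?thesis
      unfolding uniformizer_nonunit_iff V(2) place_at_def by blast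
  qed
qed

text \<open>Read off from the places: the place at \<open>P'\<close> lies over \<open>H P\<close>,
  and distinct points have distinct places.\<close>

lemma H_fibre:
  assumes "H P' = H P"
  shows "P' \<in> {P, s P, s (s P)}"
proof -
  have "place_at P' \<in> place_at ` {P, s P, s (s P)}"
    using places_over_H[of P] place_at_in_places_over[of P'] assms by (metis subsetD)
  then show ?thesis
    unfolding inj_image_mem_iff[OF inj_place_at] .
qed

text \<open>Outside the poles \<open>H\<close> is the sum over an orbit that \<open>s\<close>
  permutes cyclically.\<close>

lemma H_s [simp]: "H (s P) = H P"
proof (cases "P \<in> {None, Some 0, Some w}")
  case True
  then show ?thesis using w by (auto simp: power2_eq_square)
next
  case False
  then obtain a where P: "P = Some a" "a \<noteq> 0" "a \<noteq> w"
    by (cases P) auto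
  let ?a1 = "w ^ 2 / (w - a)"
  have "?a1 \<noteq> 0" "?a1 \<noteq> w"
    using P w by (simp_all add: field_simps power2_eq_square)
  moreover have "Some (w ^ 2 / (w - ?a1)) = Some (w * (a - w) / a)"
    using s_s[OF P(2,3)] P calculation by simp
  moreover have "Some (w * (?a1 - w) / ?a1) = Some a"
    using s_s[OF calculation(1,2)] s_cubed[of "Some a"] P by simp
  ultimately show ?thesis
    using P by (simp add: add_ac)
qed

lemma H_vimage: "H -` {H P} = {P, s P, s (s P)}"
  using H_fibre by auto

lemma places_over_eq: "places_over (H P) = place_at ` (H -` {H P})"
  using places_over_H[of P] place_at_in_places_over unfolding H_vimage
  by (auto simp del: H.simps) (metis H_s)+

text \<open>Over a value of \<open>H\<close> the places correspond to the points of the fibre.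
  Otherwise the fibre cubic has no root, hence is irreducible, and its local ring gives the only
  possible place; neither cardinality is then 3.\<close>

lemma card_places_over: "card (places_over b) = 3 \<longleftrightarrow> card (H -` {b}) = 3"
proof (cases "b \<in> range H")
  case True
  then obtain P where b: "b = H P" by blast
  show ?thesis
    unfolding b places_over_eq by (simp add: card_image inj_on_subset[OF inj_place_at])
next
  case False
  then have empty: "H -` {b} = {}" by blast
  \<comment> \<open>Infinity is a value of \<open>H\<close>, so a point with empty fibre is
    finite.\<close>
  obtain d where d: "b = Some d"
    using False by (cases b) (metis H.simps(1) rangeI)+
  define p where "p = [:w ^ 3, d * w - 3 * w ^ 2, - d, 1:]"
  have "poly p a \<noteq> 0" for a
  proof
    assume root: "poly p a = 0"
    \<comment> \<open>A root of \<open>p\<close> avoids the poles 0 and \<open>w\<close>, so it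
      would be a preimage of \<open>b\<close>.\<close>
    have "poly p 0 = w ^ 3" "poly p w = - (w ^ 3)"
      by (simp_all add: p_def algebra_simps power2_eq_square power3_eq_cube)
    then have "a \<noteq> 0" "a \<noteq> w"
      using w root by auto
    moreover have "d = a + w ^ 2 / (w - a) + w * (a - w) / a"
      using calculation root by (simp add: p_def divide_simps) (simp add: algebra_simps power2_eq_square power3_eq_cube)
    ultimately have "H (Some a) = b"
      by (simp add: d)
    with False show False by blast
  qed
  then have "irreducible p"
    by (intro irreducible_cubic) (simp_all add: p_def)
  have "places_over b \<subseteq> {nonunits (local_ring p)}"
  proof
    fix Q assume Q: "Q \<in> places_over b"
    then obtain V where V: "valuation V" "Q = nonunits V"
      using places_over_subset by blast
    have "h - const_rf d \<in> nonunits V"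
      using Q unfolding V(2) places_over_iff[OF V(1)] subst_uniformizer d by simp
    from h_residue_imp[OF V(1) this] have "V = local_ring p"
      by (intro valuation.eq_local_ring[OF V(1)] \<open>irreducible p\<close>) (simp_all only: p_def)
    with V show "Q \<in> {nonunits (local_ring p)}" by simp
  qed
  from card_mono[OF _ this] show ?thesis
    unfolding empty by simp
qed

section \<open>Degree and evaluation of the cubic function\<close>

lemma lowest_terms_h: "lowest_terms h = ([:w ^ 3, - 3 * w ^ 2, 0, 1:], [:0, - w, 1:])"
proof -
  let ?f = "[:w ^ 3, - 3 * w ^ 2, 0, 1:]" and ?g = "[:0, - w, 1:]"
  have g: "?g = [:0, 1:] * [:- w, 1:]"
    by simp
  have f0: "poly ?f 0 \<noteq> 0" "poly ?f w \<noteq> 0"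
    using w by (simp_all add: algebra_simps power2_eq_square power3_eq_cube)
  have h: "h = Fract ?f ?g"
    unfolding Fract_eq_ev h_def by (simp add: algebra_simps power2_eq_square power3_eq_cube)
  \<comment> \<open>The quotients of \<open>?f\<close> by the two linear factors of
    \<open>?g\<close>. The remainders are \<open>w ^ 3\<close> and \<open>- (w ^ 3)\<close>, and
    expanding their product gives the Bezout identity.\<close>
  let ?k1 = "[:- 3 * w ^ 2, 0, 1:]" and ?k2 = "[:- 2 * w ^ 2, w, 1:]"
  have bezout: "?f * (?f - [:0, 1:] * ?k1 - [:- w, 1:] * ?k2) + ?g * (?k1 * ?k2) = [:- (w ^ 6):]"
    by (simp add: algebra_simps power2_eq_square power3_eq_cube numeral_eq_Suc)
  have "coprime ?f ?g"
  proof (rule coprimeI)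
    fix d assume "d dvd ?f" "d dvd ?g"
    then have "d dvd [:- (w ^ 6):]"
      unfolding bezout[symmetric] by (intro dvd_add dvd_mult2)
    moreover have "[:- (w ^ 6):] dvd 1"
      using w by (simp add: is_unit_const_poly_iff dvd_field_iff)
    ultimately show "d dvd 1"
      using dvd_trans by blast
  qed
  moreover have "f' = ?f \<and> g' = ?g"
    if "lead_coeff g' = 1" "coprime f' g'" "h = Fract f' g'" for f' g'
  proof -
    have "g' \<noteq> 0" using that by auto
    then have eq: "?f * g' = f' * ?g"
      using that h by (simp add: eq_fract)
    \<comment> \<open>At the roots 0 and \<open>w\<close> of \<open>?g\<close> the numerator
      \<open>?f\<close> does not vanish, so \<open>g'\<close> does. Hence \<open>g'\<close> is a
      multiple of \<open>?g\<close>, and coprimality with monicity forces the cofactor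
      \<open>m\<close> to be 1.\<close>
    have "poly ?f 0 * poly g' 0 = 0" "poly ?f w * poly g' w = 0"
      unfolding poly_mult[symmetric] eq by (simp_all add: algebra_simps)
    then have "poly g' 0 = 0" "poly g' w = 0"
      using f0 by auto
    then obtain k where k: "g' = [:0, 1:] * k"
      using poly_eq_0_iff_dvd[of g' 0] by (auto elim: dvdE)
    then have "poly k w = 0"
      using \<open>poly g' w = 0\<close> w by simp
    then obtain m where "k = [:- w, 1:] * m"
      using poly_eq_0_iff_dvd[of k w] by (auto elim: dvdE)
    then have m: "g' = ?g * m"
      unfolding k g by (simp only: mult.assoc)
    then have "?g * (?f * m) = ?g * f'"
      using eq by (simp only: mult_ac)
    then have "f' = ?f * m"
      by (metis mult_left_cancel pCons_eq_0_iff one_neq_zero)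
    then have "m dvd 1"
      using m that(2) by (metis coprime_common_divisor dvd_triv_right)
    then obtain e where "m = [:e:]"
      by (metis is_unit_poly_iff)
    moreover have "lead_coeff m = 1"
      using that(1) unfolding m lead_coeff_mult by simp
    ultimately have "m = 1"
      by (simp add: one_pCons)
    with m \<open>f' = ?f * m\<close> show ?thesis by simp
  qed
  ultimately show ?thesis
    unfolding lowest_terms_def using h
    by (intro the_equality) (auto simp del: mult_minus_left)
qed

lemma rf_degree_h: "rf_degree h = 3"
  by (simp add: rf_degree_def lowest_terms_h)

lemma rf_eval_h: "rf_eval h = H"
proof
  fix P show "rf_eval h P = H P"
  proof (cases P)
    case None
    \<comment> \<open>In degree 3 the coefficients of numerator and denominator are 1 and 0, so the
      value at infinity is infinity.\<close>
    then show ?thesis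
      unfolding rf_eval_def rf_degree_h lowest_terms_h
      by (simp add: proj_quot_def numeral_eq_Suc)
  next
    case (Some a)
    show ?thesis
      unfolding rf_eval_def lowest_terms_h Some
      by (auto simp: proj_quot_def divide_simps) (simp_all add: algebra_simps power2_eq_square power3_eq_cube)
  qed
qed

section \<open>Counting the full fibres\<close>

definition S where "S = {b. card (H -` {b}) = 3}"

text \<open>Rational places of \<open>K\<close> are images of the places of points, and
  \<open>card_places_over\<close> turns total splitting into a condition on fibres.\<close>

lemma T1_split_h: "T1_split h = (\<lambda>b. h.subst ` place_at b) ` S"
proof -
  have "{Q \<in> places UNIV. h.subst ` place_at b \<subseteq> Q} = places_over b" for b
    using h.place_subset_iff by (auto simp: places_over_def places_UNIV)
  then show ?thesis
    unfolding T1_split_def h.const_adjoin_eq_range h.rational_places_range rf_degree_h S_def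
    using card_places_over by auto
qed

lemma card_T1_split_h: "card (T1_split h) = card S"
proof -
  have "inj (\<lambda>b. h.subst ` place_at b)"
    by (rule injI) (simp add: inj_image_eq_iff[OF h.inj_subst] inj_eq[OF inj_place_at])
  then show ?thesis
    unfolding T1_split_h by (rule card_image[OF inj_on_subset[OF _ subset_UNIV]])
qed

text \<open>The fibres over the points of \<open>S\<close>, enumerated from 1, serve as the disjoint
  sets.\<close>

lemma good_h:
  assumes "finite S" "card S \<ge> 1"
  shows "good_rf 2 (card S) h"
proof -
  obtain t where t: "bij_betw t {1..card S} S"
    by (rule exE[OF ex_bij_betw_nat_finite_1[OF assms(1)]])
  have "disjoint_family_on (\<lambda>i. H -` {t i}) {1..card S}"
    using inj_onD[OF bij_betw_imp_inj_on[OF t]] unfolding disjoint_family_on_def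
    by (intro ballI impI) (metis disjoint_iff vimage_singleton_eq)
  moreover have "card (H -` {t i}) = 2 + 1 \<and> (\<exists>u. H ` (H -` {t i}) = {u})"
    if "i \<in> {1..card S}" for i
  proof -
    have "t i \<in> S"
      by (rule bij_betw_apply[OF t that])
    then have *: "card (H -` {t i}) = 3"
      by (simp add: S_def)
    then have "H -` {t i} \<noteq> {}"
      by auto
    then obtain P where "H P = t i"
      by auto
    then have "t i \<in> range H"
      by (metis rangeI)
    then have "H ` (H -` {t i}) = {t i}"
      unfolding image_vimage_eq by simp
    with * show ?thesis by simp
  qed
  ultimately show ?thesis
    using assms(2) unfolding good_rf_def rf_degree_h rf_eval_h
    by (intro conjI exI[of _ "\<lambda>i. H -` {t i}"] ballI) simp_all
qed

lemma s_s_eq_iff: "s (s P) = P \<longleftrightarrow> s P = P" "s (s P) = s P \<longleftrightarrow> s P = P"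
  by (metis s_cubed)+

text \<open>Since \<open>s\<close> has order dividing three, any coincidence among \<open>P\<close>,
  \<open>s P\<close> and \<open>s (s P)\<close> makes \<open>P\<close> a fixed point.\<close>

lemma card_H_vimage: "card (H -` {H P}) = (if s P = P then 1 else 3)"
proof (cases "s P = P")
  case False
  then have "P \<noteq> s P" "P \<noteq> s (s P)" "s P \<noteq> s (s P)"
    using s_s_eq_iff by metis+
  with False show ?thesis
    unfolding H_vimage by simp
qed (simp add: H_vimage)

lemma card_S:
  assumes "finite (UNIV :: 'a set)"
  shows "card S = (CARD('a) + 1) div 3"
proof -
  define F where "F = {P. s P = P}"
  have fin: "finite (A :: 'a option set)" for A
    using assms by (metis finite_option_UNIV finite_subset subset_UNIV)
  \<comment> \<open>The quadratic is the equation \<open>a * (w - a) = w ^ 2\<close>; infinity is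
    moved to 0 and so is not fixed.\<close>
  have "F \<subseteq> Some ` {a. poly [:w ^ 2, - w, 1:] a = 0}"
  proof
    fix P assume "P \<in> F"
    then have "s P = P" by (simp add: F_def)
    then obtain a where P: "P = Some a" "a \<noteq> w" "w ^ 2 / (w - a) = a"
      by (cases P) (auto split: if_splits)
    then have "poly [:w ^ 2, - w, 1:] a = 0"
      by (simp add: field_simps power2_eq_square)
    with P show "P \<in> Some ` {a. poly [:w ^ 2, - w, 1:] a = 0}" by blast
  qed
  moreover have "finite {a. poly [:w ^ 2, - w, 1:] a = 0}" "card {a. poly [:w ^ 2, - w, 1:] a = 0} \<le> 2"
    using poly_roots_finite[of "[:w ^ 2, - w, 1:]"] card_poly_roots_bound[of "[:w ^ 2, - w, 1:]"] by simp_all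
  ultimately have F: "card F \<le> 2"
    by (meson card_image_le card_mono finite_imageI le_trans)
  \<comment> \<open>A point that is not fixed lies in a fibre of size 3, so the full fibres exhaust
    the complement of \<open>F\<close>.\<close>
  have UNIV_eq: "UNIV = F \<union> (\<Union>b\<in>S. H -` {b})"
    by (auto simp: F_def S_def card_H_vimage split: if_splits)
  have "F \<inter> (\<Union>b\<in>S. H -` {b}) = {}"
  proof -
    have False if "s P = P" "H P \<in> S" for P
      using that card_H_vimage[of P] by (simp add: S_def)
    then show ?thesis by (auto simp: F_def)
  qed
  then have "card (UNIV :: 'a option set) = card F + card (\<Union>b\<in>S. H -` {b})"
    unfolding UNIV_eq by (intro card_Un_disjoint fin)
  also have "card (\<Union>b\<in>S. H -` {b}) = (\<Sum>b\<in>S. card (H -` {b}))"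
    by (intro card_UN_disjoint) (auto intro: fin)
  also have "\<dots> = 3 * card S"
    by (simp add: S_def)
  finally have "CARD('a) + 1 = card F + 3 * card S"
    using assms by (simp add: card_UNIV_option)
  with F show ?thesis by presburger
qed

end

theorem proposition5p5:
  fixes w :: "'a::{field, finite}" and q :: nat and x h :: "'a poly fract"
  assumes "q = CARD('a)" and "w \<noteq> 0"
    and "x = var_rf"
    and "h = (x ^ 3 - 3 * const_rf w ^ 2 * x + const_rf w ^ 3) / (x * (x - const_rf w))"
  shows "galois_over (const_adjoin h)
    \<and> (\<forall>m. q = 3 ^ m \<longrightarrow> card (T1_split h) = q div 3 \<and> good_rf 2 (q div 3) h)
    \<and> (q mod 3 = 1 \<longrightarrow> card (T1_split h) = (q - 1) div 3 \<and> good_rf 2 ((q - 1) div 3) h)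
    \<and> (q mod 3 = 2 \<longrightarrow> card (T1_split h) = (q + 1) div 3 \<and> good_rf 2 ((q + 1) div 3) h)"
proof -
  interpret C: cubic w
    by unfold_locales fact
  have h: "h = C.h"
    unfolding assms(3,4) C.h_def ..
  \<comment> \<open>\<open>q \<ge> 2\<close> makes \<open>(q + 1) div 3\<close> positive, as
    \<open>good_rf\<close> demands, and excludes \<open>m = 0\<close> in the case
    \<open>q = 3 ^ m\<close>.\<close>
  have "card {0, 1 :: 'a} \<le> CARD('a)"
    by (intro card_mono) auto
  then have q: "q \<ge> 2"
    unfolding assms(1) by simp
  have S: "card C.S = (q + 1) div 3"
    using C.card_S assms(1) by simp
  have "card (T1_split h) = (q + 1) div 3" "good_rf 2 ((q + 1) div 3) h"
    using C.card_T1_split_h C.good_h S q unfolding h by (simp_all add: finite_subset[OF subset_UNIV])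
  moreover have "(q + 1) div 3 = q div 3" if "q = 3 ^ m" for m
    using that q by (cases m) simp_all
  moreover have "(q + 1) div 3 = (q - 1) div 3" if "q mod 3 = 1"
    using that by presburger
  ultimately show ?thesis
    using C.galois_over_K unfolding h by metis
qed

end
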